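(* Let $N\ge 1$, $0<\theta\le 2$, $p=p_\theta:=1+\theta/N$ and $\beta>0$. For $s>0$, set $$\Psi_\beta(s):=s[\log(e+s)]^\beta,\qquad \rho(s):=s^{-N}\left[\log\left(e+\frac1s\right)\right]^{-\frac N\theta}.$$ Then there exists $\gamma_4>0$ such that, if $\mu$ is a nonnegative measurable function in $\mathbf{R}^N$ satisfying $$\sup_{x\in\mathbf{R}^N}\Psi_\beta^{-1}\left[\frac{1}{|B(x,\sigma)|}\int_{B(x,\sigma)}\Psi_\beta\big(T^{\frac{1}{p-1}}\mu(y)\big)\,dy\right]\le\gamma_4\,\rho(\sigma T^{-\frac1\theta}),\qquad 0<\sigma<T^{1/\theta},$$ for some $T>0$, then the Cauchy problem $\partial_t u+(-\Delta)^{\theta/2}u=u^p$, $u(0)=\mu$, possesses a solution in $\mathbf{R}^N\times[0,T)$ (in the sense of the context).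
   Context: $B(x,r)=\{y\in\mathbf{R}^N:|x-y|<r\}$ and $|B(x,r)|$ is its volume. $\Psi_\beta^{-1}$ is the inverse function of $\Psi_\beta$ (with $\Psi_\beta(0)=0$). A nonnegative locally integrable function $\mu$ is identified with the Radon measure $\mu\,dx$. $G=G(x,t)$ denotes the fundamental solution of $\partial_t u+(-\Delta)^{\theta/2}u=0$ in $\mathbf{R}^N\times(0,\infty)$, i.e. the positive smooth kernel with $\int_{\mathbf{R}^N}G(x,t)e^{-i\xi\cdot x}\,dx=e^{-t|\xi|^\theta}$ (the Gauss kernel $(4\pi t)^{-N/2}e^{-|x|^2/4t}$ when $\theta=2$). For a Radon measure $\mu$ in $\mathbf{R}^N$ and $0<T\le\infty$, a nonnegative measurable function $u$ in $\mathbf{R}^N\times(0,T)$ is a solution of the Cauchy problem $\partial_t u+(-\Delta)^{\theta/2}u=u^p$, $u(0)=\mu$, in $\mathbf{R}^N\times[0,T)$ if $$\infty>u(x,t)=\int_{\mathbf{R}^N}G(x-y,t)\,d\mu(y)+\int_0^t\int_{\mathbf{R}^N}G(x-y,t-s)u(y,s)^p\,dy\,ds$$ for almost all $x\in\mathbf{R}^N$ and $0<t<T$. *)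

theory Defs
  imports "HOL-Analysis.Analysis"
begin

primrec Ck_on :: "nat \<Rightarrow> 'b::euclidean_space set \<Rightarrow> ('b \<Rightarrow> real) \<Rightarrow> bool" where
  "Ck_on 0 S f \<longleftrightarrow> continuous_on S f"
| "Ck_on (Suc k) S f \<longleftrightarrow> continuous_on S f \<and>
     (\<forall>b\<in>Basis. \<exists>g. Ck_on k S g \<and>
        (\<forall>x\<in>S. ((\<lambda>h. f (x + h *\<^sub>R b)) has_real_derivative g x) (at 0)))"

definition smooth_on :: "'b::euclidean_space set \<Rightarrow> ('b \<Rightarrow> real) \<Rightarrow> bool" where
  "smooth_on S f \<longleftrightarrow> (\<forall>k. Ck_on k S f)"

text \<open>The fundamental solution of \<open>\<partial>\<^sub>t u + (-\<Delta>)\<^bsup>\<theta>/2\<^esup> u = 0\<close>, characterised as the positive smooth kernel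
  whose spatial Fourier transform is \<open>exp (- t |\<xi>|\<^sup>\<theta>)\<close>. This determines \<open>G x t\<close> for all \<open>t > 0\<close>;
  the values for \<open>t \<le> 0\<close> are irrelevant.\<close>

definition fundamental_solution :: "real \<Rightarrow> ('a::euclidean_space \<Rightarrow> real \<Rightarrow> real) \<Rightarrow> bool" where
  "fundamental_solution \<theta> G \<longleftrightarrow>
     (\<forall>x. \<forall>t>0. G x t > 0) \<and>
     smooth_on (UNIV \<times> {0<..}) (\<lambda>(x, t). G x t) \<and>
     (\<forall>t>0. integrable lborel (\<lambda>x. G x t)) \<and>
     (\<forall>t>0. \<forall>\<xi>. (\<integral>x. complex_of_real (G x t) * exp (- (\<i> * complex_of_real (\<xi> \<bullet> x))) \<partial>lborel)
        = complex_of_real (exp (- t * norm \<xi> powr \<theta>)))"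

definition radon_measure :: "'a::euclidean_space measure \<Rightarrow> bool" where
  "radon_measure M \<longleftrightarrow> sets M = sets borel \<and> (\<forall>K. compact K \<longrightarrow> emeasure M K < \<infinity>)"

text \<open>The Borel measure \<open>\<mu> dx\<close>. As \<open>\<mu>\<close> is only Lebesgue measurable, the density is taken with respect to
  \<open>lebesgue\<close> and the result is restricted to the Borel sets by transport along the identity.\<close>

definition function_measure :: "('a::euclidean_space \<Rightarrow> real) \<Rightarrow> 'a measure" where
  "function_measure \<mu> = distr (density lebesgue (\<lambda>x. ennreal (\<mu> x))) borel (\<lambda>x. x)"

text \<open>A solution of \<open>\<partial>\<^sub>t u + (-\<Delta>)\<^bsup>\<theta>/2\<^esup> u = u\<^sup>p\<close>, \<open>u(0) = M\<close>, in \<open>\<real>\<^sup>N \<times> [0,T)\<close>, where \<open>G\<close> is the fundamental solution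
  and \<open>0 < T \<le> \<infinity>\<close>. Since \<open>u\<close> is real-valued, the equation in \<open>ennreal\<close> contains the finiteness of both sides.\<close>

definition cauchy_solution ::
  "('a::euclidean_space \<Rightarrow> real \<Rightarrow> real) \<Rightarrow> real \<Rightarrow> 'a measure \<Rightarrow> ereal \<Rightarrow> ('a \<times> real \<Rightarrow> real) \<Rightarrow> bool" where
  "cauchy_solution G p M T u \<longleftrightarrow>
     radon_measure M \<and>
     u \<in> borel_measurable (lebesgue_on (UNIV \<times> {t. 0 < t \<and> ereal t < T})) \<and>
     (\<forall>x t. 0 < t \<and> ereal t < T \<longrightarrow> 0 \<le> u (x, t)) \<and>
     (AE x in lebesgue. \<forall>t. 0 < t \<and> ereal t < T \<longrightarrow>
        ennreal (u (x, t)) =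
          (\<integral>\<^sup>+ y. ennreal (G (x - y) t) \<partial>M) +
          (\<integral>\<^sup>+ s\<in>{0<..<t}. (\<integral>\<^sup>+ y. ennreal (G (x - y) (t - s) * u (y, s) powr p) \<partial>lebesgue) \<partial>lebesgue))"

definition Psi :: "real \<Rightarrow> real \<Rightarrow> real" where
  "Psi \<beta> s = s * ln (exp 1 + s) powr \<beta>"

text \<open>The inverse of \<open>Psi \<beta>\<close> as a bijection of \<open>[0,\<infinity>)\<close>, extended by \<open>\<infinity> \<mapsto> \<infinity>\<close> so that it applies
  to averages that may be infinite.\<close>

definition Psi_inv :: "real \<Rightarrow> ennreal \<Rightarrow> ennreal" where
  "Psi_inv \<beta> a = (if a = \<infinity> then \<infinity> else ennreal (the_inv_into {0..} (Psi \<beta>) (enn2real a)))"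

definition rho :: "nat \<Rightarrow> real \<Rightarrow> real \<Rightarrow> real" where
  "rho N \<theta> s = s powr (- real N) * ln (exp 1 + 1 / s) powr (- (real N / \<theta>))"

definition average :: "('a::euclidean_space \<Rightarrow> real) \<Rightarrow> 'a set \<Rightarrow> ennreal" where
  "average f B = (\<integral>\<^sup>+ y\<in>B. ennreal (f y) \<partial>lebesgue) / emeasure lebesgue B"

end

theory Submission
  imports Defs "HOL-Probability.Probability"
begin

text \<open>
  Let \<open>f = \<Psi>(M \<mu>)\<close> with \<open>M = T powr (1 / (p - 1))\<close>, let \<open>F\<close> be the free evolution of \<open>f\<close>, \<open>W = \<Psi>\<^sup>-\<^sup>1(F)\<close>
  and \<open>w = W / M\<close>. Then \<open>4 w\<close> is a supersolution. The smoothing estimate for the free evolution turns the hypothesis into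
  \<open>W \<le> c \<rho>((t / T)\<^bsup>1/\<theta>\<^esup>)\<close> with a small \<open>c\<close>; hence \<open>w\<^sup>p\<close> is at most a small multiple of \<open>F\<close> times the
  weight \<open>s\<^sup>-\<^sup>1 (1 + log (T / s) / \<theta>)\<^bsup>-1-\<beta>\<^esup>\<close>. This weight is integrable at \<open>0\<close>, and by the semigroup property the
  Duhamel term is bounded by a small multiple of \<open>(1 + log (T / t) / \<theta>)\<^bsup>-\<beta>\<^esup> F\<close>, which is controlled by \<open>w\<close>.
  Monotone iteration below the supersolution gives the solution.

  The smoothing estimate only needs that the kernel is radially decreasing, has mass one and is bounded by a multiple of
  \<open>t\<^bsup>-N/\<theta>\<^esup>\<close>. Radial monotonicity holds because \<open>exp (- t |\<xi>|\<^sup>\<theta>)\<close> is a limit of positive combinations of Gaussians, as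
  is seen from \<open>|\<xi>|\<^sup>\<theta> = lim n\<^bsup>\<theta>/2\<^esup> (1 - exp (- |\<xi>|\<^sup>2 / n))\<^bsup>\<theta>/2\<^esup>\<close>: in the binomial series of \<open>1 - (1 - z)\<^bsup>\<theta>/2\<^esup>\<close>
  all coefficients are nonnegative.
\<close>

section \<open>Gaussian integrals\<close>

text \<open>At the critical exponent p - 1 = \<theta> / N the bound W \<le> c \<rho> alone makes
  W^(p-1) of order 1 / (s log(1/s)), whose integral diverges at 0. The missing decay comes from
  writing one factor of W^p as W = F / ln(e + W)^\<beta>: this gains the power -\<beta> of the
  logarithm, and it makes the source linear in F, so that the semigroup property applies. The gain
  must persist where W is far below \<rho> and its logarithm is small; half of the power p - 1 of
  the ratio W / \<rho> pays for that, and the other half supplies the small factor. The number 4 is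
  2 + 2: one share bounds the free evolution of \<mu>, the other the Duhamel term. For general
  \<theta> no formula for \<open>G\<close> is at hand. Everything used about it is extracted from
  its Fourier transform, positivity and continuity, which is why an inversion theorem for
  nonnegative continuous functions comes early.\<close>

lemma lborel_integral_prod_Basis:
  fixes f :: "'a::euclidean_space \<Rightarrow> real \<Rightarrow> 'c::{real_normed_field,banach,second_countable_topology}"
  assumes f: "\<And>b. b \<in> Basis \<Longrightarrow> integrable lborel (f b)"
  shows "integrable lborel (\<lambda>x::'a. \<Prod>b\<in>Basis. f b (x \<bullet> b))"
    and "integral\<^sup>L lborel (\<lambda>x::'a. \<Prod>b\<in>Basis. f b (x \<bullet> b)) = (\<Prod>b\<in>Basis. integral\<^sup>L lborel (f b))"
proof -
  interpret P: product_sigma_finite "\<lambda>_::'a. lborel :: real measure" ..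
  let ?g = "\<lambda>x::'a. \<Prod>b\<in>Basis. f b (x \<bullet> b)"
  let ?s = "\<lambda>h::'a \<Rightarrow> real. \<Sum>b\<in>Basis. h b *\<^sub>R b"
  have m[measurable]: "f b \<in> borel_measurable borel" if "b \<in> Basis" for b
    using f[OF that] by simp
  have gm: "?g \<in> borel_measurable borel" by measurable
  have sm: "?s \<in> measurable (\<Pi>\<^sub>M b\<in>Basis. lborel) borel" by measurable
  have gs: "?g (?s h) = (\<Prod>b\<in>Basis. f b (h b))" for h
    by (intro prod.cong refl) simp
  have "integrable (\<Pi>\<^sub>M b\<in>Basis. lborel) (\<lambda>h. \<Prod>b\<in>Basis. f b (h b))"
    by (intro P.product_integrable_prod f) auto
  then show "integrable lborel ?g"
    unfolding lborel_eq[where 'a = 'a] by (subst integrable_distr_eq[OF sm gm]) (simp only: gs)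
  show "integral\<^sup>L lborel ?g = (\<Prod>b\<in>Basis. integral\<^sup>L lborel (f b))"
    unfolding lborel_eq[where 'a = 'a]
    by (subst integral_distr[OF sm gm], simp only: gs) (intro P.product_integral_prod f, auto)
qed

text \<open>Rescaled form of the characteristic function of the standard normal law:
  \<open>c\<close> satisfies c^2 / 2 = \<delta>, so the substitution y -> c y turns exp(-y^2 / 2)
  into the present Gaussian.\<close>

lemma gaussian_real:
  fixes x \<delta> :: real
  assumes "\<delta> > 0"
  shows "integrable lborel (\<lambda>y. cis (x * y) * complex_of_real (exp (- \<delta> * y\<^sup>2)))"
    and "(\<integral>y. cis (x * y) * complex_of_real (exp (- \<delta> * y\<^sup>2)) \<partial>lborel)
       = complex_of_real (sqrt (pi / \<delta>) * exp (- x\<^sup>2 / (4 * \<delta>)))"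
proof -
  define c where "c = sqrt (2 * \<delta>)"
  have c: "c > 0" "c\<^sup>2 = 2 * \<delta>" using assms by (auto simp: c_def)
  define f where "f y = std_normal_density y *\<^sub>R iexp (x / c * y)" for y
  define g where "g y = cis (x * y) * complex_of_real (exp (- \<delta> * y\<^sup>2))" for y
  have fm: "f \<in> borel_measurable lborel" unfolding f_def by measurable
  have fi: "integrable lborel f"
    by (rule Bochner_Integration.integrable_bound[OF integrable_normal_density[where \<mu> = 0 and \<sigma> = 1, OF zero_less_one] fm])
       (rule AE_I2, simp add: f_def norm_mult)
  have fI: "integral\<^sup>L lborel f = exp (- ((x / c)^2) / 2)"
    using fun_cong[OF char_std_normal_distribution, of "x / c"]
    unfolding char_def f_def by (subst (asm) integral_density) auto
  have fg: "f (0 + c * y) = (1 / sqrt (2 * pi)) *\<^sub>R g y" for y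
  proof -
    have "iexp (x / c * (c * y)) = cis (x * y)" using c by (simp add: cis_conv_exp)
    moreover have "std_normal_density (c * y) = (1 / sqrt (2 * pi)) * exp (- \<delta> * y\<^sup>2)"
      using c by (simp add: std_normal_density_def power_mult_distrib)
    ultimately show ?thesis by (simp add: f_def g_def scaleR_conv_of_real)
  qed
  have "integrable lborel (\<lambda>y. f (0 + c * y))"
    by (intro lborel_integrable_real_affine[OF fi]) (use c in auto)
  then have "integrable lborel (\<lambda>y. sqrt (2 * pi) *\<^sub>R (1 / sqrt (2 * pi)) *\<^sub>R g y)"
    unfolding fg by (rule integrable_scaleR_right)
  then show gi: "integrable lborel (\<lambda>y. cis (x * y) * complex_of_real (exp (- \<delta> * y\<^sup>2)))"
    unfolding g_def[symmetric] by simp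
  have "integral\<^sup>L lborel f = \<bar>c\<bar> *\<^sub>R (\<integral>y. f (0 + c * y) \<partial>lborel)"
    by (rule lborel_integral_real_affine) (use c in auto)
  also have "\<dots> = (c / sqrt (2 * pi)) *\<^sub>R integral\<^sup>L lborel g"
    using c unfolding fg by simp
  finally have "integral\<^sup>L lborel g = (sqrt (2 * pi) / c) *\<^sub>R integral\<^sup>L lborel f"
    using c by simp
  moreover have "sqrt (2 * pi) / c = sqrt (pi / \<delta>)"
    using assms by (simp add: c_def real_sqrt_divide real_sqrt_mult)
  moreover have "(x / c)\<^sup>2 / 2 = x\<^sup>2 / (4 * \<delta>)" using c by (simp add: power_divide)
  ultimately show "(\<integral>y. cis (x * y) * complex_of_real (exp (- \<delta> * y\<^sup>2)) \<partial>lborel)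
       = complex_of_real (sqrt (pi / \<delta>) * exp (- x\<^sup>2 / (4 * \<delta>)))"
    unfolding g_def[symmetric] fI by (simp add: scaleR_conv_of_real exp_of_real)
qed

lemma gaussian_euclidean:
  fixes x :: "'a::euclidean_space"
  assumes "\<delta> > 0"
  shows "integrable lborel (\<lambda>\<xi>. cis (x \<bullet> \<xi>) * complex_of_real (exp (- \<delta> * (norm \<xi>)\<^sup>2)))"
    and "(\<integral>\<xi>. cis (x \<bullet> \<xi>) * complex_of_real (exp (- \<delta> * (norm \<xi>)\<^sup>2)) \<partial>lborel)
       = complex_of_real (sqrt (pi / \<delta>) ^ DIM('a) * exp (- (norm x)\<^sup>2 / (4 * \<delta>)))"
proof -
  let ?f = "\<lambda>b y. cis ((x \<bullet> b) * y) * complex_of_real (exp (- \<delta> * y\<^sup>2))"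
  have n2: "(norm z)\<^sup>2 = (\<Sum>b\<in>Basis. (z \<bullet> b)\<^sup>2)" for z :: 'a
    unfolding power2_norm_eq_inner by (subst euclidean_inner) (simp add: power2_eq_square)
  have cs: "cis (\<Sum>b\<in>Basis. h b) = (\<Prod>b\<in>Basis. cis (h b))" for h :: "'a \<Rightarrow> real"
    by (simp add: cis_conv_exp sum_distrib_left exp_sum)
  have eq: "cis (x \<bullet> \<xi>) * complex_of_real (exp (- \<delta> * (norm \<xi>)\<^sup>2)) = (\<Prod>b\<in>Basis. ?f b (\<xi> \<bullet> b))" for \<xi>
    by (simp add: euclidean_inner[of x \<xi>] cs n2 sum_distrib_left exp_sum prod.distrib flip: sum_negf)
  show "integrable lborel (\<lambda>\<xi>. cis (x \<bullet> \<xi>) * complex_of_real (exp (- \<delta> * (norm \<xi>)\<^sup>2)))"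
    unfolding eq by (rule lborel_integral_prod_Basis(1)) (rule gaussian_real(1)[OF assms])
  show "(\<integral>\<xi>. cis (x \<bullet> \<xi>) * complex_of_real (exp (- \<delta> * (norm \<xi>)\<^sup>2)) \<partial>lborel)
       = complex_of_real (sqrt (pi / \<delta>) ^ DIM('a) * exp (- (norm x)\<^sup>2 / (4 * \<delta>)))"
    unfolding eq
    by (subst lborel_integral_prod_Basis(2)[OF gaussian_real(1)[OF assms]], subst gaussian_real(2)[OF assms])
       (simp add: prod.distrib n2 sum_divide_distrib exp_sum flip: of_real_prod sum_negf)
qed

lemma gaussian_integrable:
  assumes "\<delta> > 0"
  shows "integrable lborel (\<lambda>\<xi>::'a::euclidean_space. exp (- \<delta> * (norm \<xi>)\<^sup>2))"
  using integrable_norm[OF gaussian_euclidean(1)[OF assms, of "0::'a"]] by simp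

lemma gaussian_cos:
  fixes x :: "'a::euclidean_space"
  assumes "\<delta> > 0"
  shows "(\<integral>\<xi>. cos (x \<bullet> \<xi>) * exp (- \<delta> * (norm \<xi>)\<^sup>2) \<partial>lborel)
       = sqrt (pi / \<delta>) ^ DIM('a) * exp (- (norm x)\<^sup>2 / (4 * \<delta>))"
proof -
  have "(\<integral>\<xi>. cos (x \<bullet> \<xi>) * exp (- \<delta> * (norm \<xi>)\<^sup>2) \<partial>lborel)
      = (\<integral>\<xi>. Re (cis (x \<bullet> \<xi>) * complex_of_real (exp (- \<delta> * (norm \<xi>)\<^sup>2))) \<partial>lborel)"
    by (intro Bochner_Integration.integral_cong) auto
  also have "\<dots> = Re (\<integral>\<xi>. cis (x \<bullet> \<xi>) * complex_of_real (exp (- \<delta> * (norm \<xi>)\<^sup>2)) \<partial>lborel)"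
    by (rule integral_Re[OF gaussian_euclidean(1)[OF assms]])
  finally show ?thesis unfolding gaussian_euclidean(2)[OF assms] by simp
qed

text \<open>Each |\<xi> \<bullet> b| is at most the norm, so with \<open>c\<close> = t / N the
  integrand lies below the product over b of exp(-c |\<xi> \<bullet> b|^\<theta>), and every
  one-dimensional factor is dominated by a multiple of 1 / (1 + y^2).\<close>

lemma exp_neg_powr_integrable:
  assumes "t > 0" "\<theta> > 0"
  shows "integrable lborel (\<lambda>\<xi>::'a::euclidean_space. exp (- t * norm \<xi> powr \<theta>))"
proof -
  define c where "c = t / real DIM('a)"
  have c: "c > 0" using assms by (simp add: c_def)
  have "((\<lambda>r::real. (1 + r\<^sup>2) * exp (- c * r powr \<theta>)) \<longlongrightarrow> 0) at_top"
    using assms c by real_asymp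
  then have "\<forall>\<^sub>F r in at_top. (1 + r\<^sup>2) * exp (- c * r powr \<theta>) < 1"
    by (rule order_tendstoD) auto
  then obtain R where R: "\<And>r. r \<ge> R \<Longrightarrow> (1 + r\<^sup>2) * exp (- c * r powr \<theta>) < 1"
    by (auto simp: eventually_at_top_linorder)
  define B where "B = 1 + (max 0 R)\<^sup>2"
  have bound: "exp (- c * \<bar>y\<bar> powr \<theta>) \<le> B * inverse (1 + y\<^sup>2)" for y :: real
  proof -
    have "(1 + \<bar>y\<bar>\<^sup>2) * exp (- c * \<bar>y\<bar> powr \<theta>) \<le> B"
    proof (cases "\<bar>y\<bar> \<ge> R")
      case True
      have "0 \<le> (max 0 R)\<^sup>2" by (rule zero_le_power2)
      then show ?thesis using R[OF True] unfolding B_def by linarith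
    next
      case False
      then have "\<bar>y\<bar>\<^sup>2 \<le> (max 0 R)\<^sup>2" by (intro power_mono) auto
      moreover have "exp (- c * \<bar>y\<bar> powr \<theta>) \<le> 1" using c by simp
      ultimately have "(1 + \<bar>y\<bar>\<^sup>2) * exp (- c * \<bar>y\<bar> powr \<theta>) \<le> (1 + (max 0 R)\<^sup>2) * 1"
        by (intro mult_mono) auto
      then show ?thesis by (simp add: B_def)
    qed
    moreover have "1 + y\<^sup>2 > 0" by (simp add: add_pos_nonneg)
    ultimately show ?thesis by (simp add: field_simps)
  qed
  have "integrable lborel (\<lambda>y::real. inverse (1 + y\<^sup>2))"
    using integrable_inverse_1_plus_square by (simp add: set_integrable_def)
  then have "integrable lborel (\<lambda>y::real. B * inverse (1 + y\<^sup>2))" by simp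
  then have 1: "integrable lborel (\<lambda>y::real. exp (- c * \<bar>y\<bar> powr \<theta>))"
    by (rule Bochner_Integration.integrable_bound) (use bound in \<open>auto intro!: AE_I2 order_trans[OF _ abs_ge_self]\<close>)
  have 2: "integrable lborel (\<lambda>\<xi>::'a. \<Prod>b\<in>Basis. exp (- c * \<bar>\<xi> \<bullet> b\<bar> powr \<theta>))"
    by (rule lborel_integral_prod_Basis(1)) (rule 1)
  show ?thesis
  proof (rule Bochner_Integration.integrable_bound[OF 2], measurable, rule AE_I2)
    fix \<xi> :: 'a
    have "(\<Sum>b\<in>Basis. \<bar>\<xi> \<bullet> b\<bar> powr \<theta>) \<le> (\<Sum>b\<in>(Basis::'a set). norm \<xi> powr \<theta>)"
      using assms by (intro sum_mono powr_mono2) (auto simp: Basis_le_norm)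
    then have "c * (\<Sum>b\<in>Basis. \<bar>\<xi> \<bullet> b\<bar> powr \<theta>) \<le> t * norm \<xi> powr \<theta>"
      using assms by (simp add: c_def field_simps)
    then have "exp (- t * norm \<xi> powr \<theta>) \<le> exp (\<Sum>b\<in>Basis. - c * \<bar>\<xi> \<bullet> b\<bar> powr \<theta>)"
      by (simp add: sum_distrib_left[symmetric] sum_negf)
    then show "norm (exp (- t * norm \<xi> powr \<theta>)) \<le> norm (\<Prod>b\<in>Basis. exp (- c * \<bar>\<xi> \<bullet> b\<bar> powr \<theta>))"
      by (simp add: exp_sum prod_nonneg)
  qed
qed

lemma nn_integral_lborel_affine:
  fixes f :: "'a::euclidean_space \<Rightarrow> ennreal"
  assumes "c \<noteq> 0" and [measurable]: "f \<in> borel_measurable borel"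
  shows "(\<integral>\<^sup>+x. f x \<partial>lborel) = ennreal (\<bar>c\<bar> ^ DIM('a)) * (\<integral>\<^sup>+x. f (t + c *\<^sub>R x) \<partial>lborel)"
  by (subst lborel_affine[OF assms(1), of t])
     (simp add: nn_integral_density nn_integral_distr nn_integral_cmult)

text \<open>Substitution \<xi> -> t^(-1/\<theta>) \<xi>. The decay rate t^(-N/\<theta>) of the
  kernel originates here.\<close>

lemma integral_exp_neg_powr_scaling:
  assumes "t > 0" "\<theta> > 0"
  shows "(\<integral>\<^sup>+(\<xi>::'a::euclidean_space). ennreal (exp (- t * norm \<xi> powr \<theta>)) \<partial>lborel)
       = ennreal (t powr (- (real DIM('a) / \<theta>))) * (\<integral>\<^sup>+(\<xi>::'a). ennreal (exp (- (norm \<xi> powr \<theta>))) \<partial>lborel)"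
proof -
  define c where "c = t powr (- (1 / \<theta>))"
  have c: "c > 0" using assms by (simp add: c_def)
  have "c powr \<theta> = t powr (- 1)" using assms by (simp add: c_def powr_powr)
  then have "t * c powr \<theta> = 1" using assms by (simp add: powr_minus)
  moreover have "c ^ DIM('a) = t powr (- (real DIM('a) / \<theta>))"
    using assms c by (subst powr_realpow[symmetric]) (simp_all add: c_def powr_powr)
  ultimately have c: "c > 0" "t * c powr \<theta> = 1" "c ^ DIM('a) = t powr (- (real DIM('a) / \<theta>))"
    using c by auto
  have "t * norm (0 + c *\<^sub>R \<xi>) powr \<theta> = norm \<xi> powr \<theta>" for \<xi> :: 'a
    using c(1,2) by (simp add: powr_mult flip: mult.assoc)
  then show ?thesis
    using c by (subst nn_integral_lborel_affine[of c _ 0]) auto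
qed

section \<open>Fourier inversion\<close>

lemma integral_lborel_affine:
  fixes f :: "'a::euclidean_space \<Rightarrow> 'b::{banach,second_countable_topology}"
  assumes "c \<noteq> 0" and [measurable]: "f \<in> borel_measurable borel"
  shows "integral\<^sup>L lborel f = (\<bar>c\<bar> ^ DIM('a)) *\<^sub>R (\<integral>x. f (t + c *\<^sub>R x) \<partial>lborel)"
  by (subst lborel_affine[OF assms(1), of t])
     (simp add: integral_density integral_distr)

lemma integrable_lborel_affine:
  fixes f :: "'a::euclidean_space \<Rightarrow> 'b::{banach,second_countable_topology}"
  assumes c: "c \<noteq> 0" and f: "integrable lborel f"
  shows "integrable lborel (\<lambda>x. f (t + c *\<^sub>R x))"
proof -
  have [measurable]: "f \<in> borel_measurable borel" using f by simp
  have "integrable lborel (\<lambda>x. \<bar>c\<bar> ^ DIM('a) *\<^sub>R f (t + c *\<^sub>R x))"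
    using f by (subst (asm) lborel_affine[OF c, of t])
      (simp add: integrable_density integrable_distr_eq)
  then have "integrable lborel (\<lambda>x. inverse (\<bar>c\<bar> ^ DIM('a)) *\<^sub>R \<bar>c\<bar> ^ DIM('a) *\<^sub>R f (t + c *\<^sub>R x))"
    by (rule integrable_scaleR_right)
  then show ?thesis using c by simp
qed

lemma borel_measurable_cis[measurable]: "cis \<in> borel_measurable borel"
  by (intro borel_measurable_continuous_onI continuous_intros)

text \<open>Supplies the hypothesis of Fubini's theorem for the oscillatory integrands below, whose
  modulus is controlled by a product of one function of each variable.\<close>

lemma integrable_product_lborel:
  fixes f :: "'a::euclidean_space \<Rightarrow> 'c::{real_normed_algebra,banach,second_countable_topology}"
    and g :: "'b::euclidean_space \<Rightarrow> 'c"
    and k :: "'a \<times> 'b \<Rightarrow> 'c"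
  assumes f: "integrable lborel f" and g: "integrable lborel g"
    and k[measurable]: "k \<in> borel_measurable (lborel \<Otimes>\<^sub>M lborel)"
    and bound: "\<And>x y. norm (k (x, y)) \<le> norm (f x) * norm (g y)"
  shows "integrable (lborel \<Otimes>\<^sub>M lborel) k"
proof -
  have [measurable]: "f \<in> borel_measurable borel" "g \<in> borel_measurable borel" using f g by auto
  have "(\<integral>\<^sup>+z. norm (k z) \<partial>(lborel \<Otimes>\<^sub>M lborel)) \<le> (\<integral>\<^sup>+z. ennreal (norm (f (fst z))) * ennreal (norm (g (snd z))) \<partial>(lborel \<Otimes>\<^sub>M lborel))"
    using bound by (intro nn_integral_mono) (auto simp: ennreal_mult'[symmetric] intro!: ennreal_leI)
  also have "\<dots> = (\<integral>\<^sup>+x. ennreal (norm (f x)) \<partial>lborel) * (\<integral>\<^sup>+y. ennreal (norm (g y)) \<partial>lborel)"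
    by (subst lborel.nn_integral_fst[symmetric]) (auto simp: nn_integral_cmult nn_integral_multc)
  also have "\<dots> < \<infinity>"
    using f g by (auto simp: integrable_iff_bounded ennreal_mult_less_top)
  finally show ?thesis by (intro integrableI_bounded) auto
qed

text \<open>Inserting the integral for \<open>h\<close>, exchanging the order and evaluating the
  inner Gaussian integral turns the damped inversion integral into a Gaussian average of
  \<open>g\<close> around \<open>x\<close> at scale \<open>r\<close>.\<close>

lemma fourier_gaussian_regularisation:
  fixes g :: "'a::euclidean_space \<Rightarrow> real" and h :: "'a \<Rightarrow> complex"
  assumes g: "integrable lborel g"
    and h: "\<And>\<xi>. h \<xi> = (\<integral>y. complex_of_real (g y) * cis (- (\<xi> \<bullet> y)) \<partial>lborel)"
    and r: "r > 0"
  shows "(\<integral>\<xi>. cis (x \<bullet> \<xi>) * h \<xi> * complex_of_real (exp (- (r\<^sup>2 / 4) * (norm \<xi>)\<^sup>2)) \<partial>lborel)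
       = complex_of_real ((2 * sqrt pi) ^ DIM('a) * (\<integral>z. g (x + r *\<^sub>R z) * exp (- (norm z)\<^sup>2) \<partial>lborel))"
proof -
  \<comment> \<open>With 4 \<delta> = r^2 the inner integral contains exp(-|x - y|^2 / r^2), which y
    = x + r z turns into exp(-|z|^2).\<close>
  define \<delta> where "\<delta> = r\<^sup>2 / 4"
  have \<delta>: "\<delta> > 0" using r by (simp add: \<delta>_def)
  have [measurable]: "g \<in> borel_measurable borel" using g by simp
  let ?e = "\<lambda>\<xi>::'a. exp (- \<delta> * (norm \<xi>)\<^sup>2)"
  let ?k = "\<lambda>\<xi> y. complex_of_real (g y) * cis ((x - y) \<bullet> \<xi>) * complex_of_real (?e \<xi>)"
  have km: "(\<lambda>(\<xi>, y). ?k \<xi> y) \<in> borel_measurable (lborel \<Otimes>\<^sub>M lborel)"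
    unfolding split_beta' by measurable
  have kI: "integrable (lborel \<Otimes>\<^sub>M lborel) (\<lambda>(\<xi>, y). ?k \<xi> y)"
    by (rule integrable_product_lborel[OF
          integrable_of_real[OF gaussian_integrable[OF \<delta>]]
          integrable_of_real[OF g] km])
       (simp add: norm_mult)
  have cis_split: "cis ((x - y) \<bullet> \<xi>) = cis (x \<bullet> \<xi>) * cis (- (\<xi> \<bullet> y))" for y \<xi>
    by (simp add: cis_mult inner_diff_left inner_commute[of \<xi>])
  have "(\<integral>\<xi>. cis (x \<bullet> \<xi>) * h \<xi> * complex_of_real (?e \<xi>) \<partial>lborel) = (\<integral>\<xi>. (\<integral>y. ?k \<xi> y \<partial>lborel) \<partial>lborel)"
  proof (intro Bochner_Integration.integral_cong refl)
    fix \<xi> :: 'a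
    have "cis (x \<bullet> \<xi>) * h \<xi> * complex_of_real (?e \<xi>)
        = (\<integral>y. cis (x \<bullet> \<xi>) * complex_of_real (?e \<xi>) * (complex_of_real (g y) * cis (- (\<xi> \<bullet> y))) \<partial>lborel)"
      unfolding h by (subst integral_mult_right_zero) (simp add: mult_ac)
    also have "\<dots> = (\<integral>y. ?k \<xi> y \<partial>lborel)"
      by (intro Bochner_Integration.integral_cong refl)
         (simp add: cis_split mult_ac)
    finally show "cis (x \<bullet> \<xi>) * h \<xi> * complex_of_real (?e \<xi>) = (\<integral>y. ?k \<xi> y \<partial>lborel)" .
  qed
  also have "\<dots> = (\<integral>y. (\<integral>\<xi>. ?k \<xi> y \<partial>lborel) \<partial>lborel)"
    by (rule lborel_pair.Fubini_integral[symmetric, OF kI])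
  also have "\<dots> = (\<integral>y. complex_of_real (g y * (sqrt (pi / \<delta>) ^ DIM('a) * exp (- (norm (x - y))\<^sup>2 / (4 * \<delta>)))) \<partial>lborel)"
  proof (intro Bochner_Integration.integral_cong refl)
    fix y
    have "(\<integral>\<xi>. ?k \<xi> y \<partial>lborel)
        = complex_of_real (g y) * (\<integral>\<xi>. cis ((x - y) \<bullet> \<xi>) * complex_of_real (?e \<xi>) \<partial>lborel)"
      by (simp only: mult.assoc integral_mult_right_zero)
    then show "(\<integral>\<xi>. ?k \<xi> y \<partial>lborel)
        = complex_of_real (g y * (sqrt (pi / \<delta>) ^ DIM('a) * exp (- (norm (x - y))\<^sup>2 / (4 * \<delta>))))"
      unfolding gaussian_euclidean(2)[OF \<delta>] by simp
  qed
  also have "\<dots> = complex_of_real (\<integral>y. g y * (sqrt (pi / \<delta>) ^ DIM('a) * exp (- (norm (x - y))\<^sup>2 / (4 * \<delta>))) \<partial>lborel)"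
    by (rule integral_complex_of_real)
  also have "(\<integral>y. g y * (sqrt (pi / \<delta>) ^ DIM('a) * exp (- (norm (x - y))\<^sup>2 / (4 * \<delta>))) \<partial>lborel)
     = r ^ DIM('a) * (\<integral>z. g (x + r *\<^sub>R z) * (sqrt (pi / \<delta>) ^ DIM('a) * exp (- (norm z)\<^sup>2)) \<partial>lborel)"
    using r by (subst integral_lborel_affine[of r _ x]) (auto simp: \<delta>_def power_mult_distrib)
  also have "\<dots> = (r * sqrt (pi / \<delta>)) ^ DIM('a) * (\<integral>z. g (x + r *\<^sub>R z) * exp (- (norm z)\<^sup>2) \<partial>lborel)"
    by (simp add: power_mult_distrib mult.left_commute[of _ "sqrt (pi / \<delta>) ^ DIM('a)"])
  also have "r * sqrt (pi / \<delta>) = 2 * sqrt pi"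
    using r by (simp add: \<delta>_def real_sqrt_divide real_sqrt_mult)
  finally show ?thesis by (simp add: \<delta>_def)
qed

lemma continuous_sequence_scaled:
  fixes g :: "'a::euclidean_space \<Rightarrow> real"
  assumes "continuous_on UNIV g"
  shows "(\<lambda>n. g (x + (1 / real (Suc n)) *\<^sub>R z)) \<longlonglongrightarrow> g x"
proof -
  have "(\<lambda>n. x + (1 / real (Suc n)) *\<^sub>R z) \<longlonglongrightarrow> x + 0 *\<^sub>R z"
    by (intro tendsto_intros LIMSEQ_Suc[OF lim_1_over_n, unfolded of_nat_Suc] | simp)+
  moreover have "isCont g x" using assms by (simp add: continuous_on_eq_continuous_at)
  ultimately show ?thesis by (auto dest: isCont_tendsto_compose)
qed

lemma gaussian_mass: "(\<integral>(z::'a::euclidean_space). exp (- (norm z)\<^sup>2) \<partial>lborel) = sqrt pi ^ DIM('a)"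
  using gaussian_cos[of 1 "0::'a"] by simp

text \<open>The damping scale tends to 0 in \<open>fourier_gaussian_regularisation\<close>:
  integrability of \<open>h\<close> controls the frequency side, continuity of \<open>g\<close> the
  space side.\<close>

theorem fourier_inversion:
  fixes g :: "'a::euclidean_space \<Rightarrow> real" and h :: "'a \<Rightarrow> complex"
  assumes cont: "continuous_on UNIV g" and nn: "\<And>x. g x \<ge> 0" and g: "integrable lborel g"
    and h: "\<And>\<xi>. h \<xi> = (\<integral>y. complex_of_real (g y) * cis (- (\<xi> \<bullet> y)) \<partial>lborel)"
    and hi: "integrable lborel h"
  shows "complex_of_real ((2 * pi) ^ DIM('a) * g x) = (\<integral>\<xi>. cis (x \<bullet> \<xi>) * h \<xi> \<partial>lborel)"
proof -
  have [measurable]: "g \<in> borel_measurable borel" "h \<in> borel_measurable borel" using g hi by auto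
  define r where "r n = 1 / real (Suc n)" for n
  have r: "r n > 0" for n by (simp add: r_def)
  define c where "c = (2 * sqrt pi) ^ DIM('a)"
  have c: "c > 0" by (simp add: c_def)
  define A where "A = (\<integral>\<xi>. norm (h \<xi>) \<partial>lborel)"
  let ?e = "\<lambda>z::'a. exp (- (norm z)\<^sup>2)"
  let ?J = "\<lambda>x n. (\<integral>\<xi>. cis (x \<bullet> \<xi>) * h \<xi> * complex_of_real (exp (- ((r n)\<^sup>2 / 4) * (norm \<xi>)\<^sup>2)) \<partial>lborel)"
  let ?I = "\<lambda>x n. (\<integral>z. g (x + r n *\<^sub>R z) * ?e z \<partial>lborel)"
  have JI: "?J x n = complex_of_real (c * ?I x n)" for x n
    unfolding c_def by (rule fourier_gaussian_regularisation[OF g h r])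
  have ei: "integrable lborel ?e" using gaussian_integrable[of 1, where 'a = 'a] by simp
  have Ii: "integrable lborel (\<lambda>z. g (x + r n *\<^sub>R z) * ?e z)" for x n
    by (rule Bochner_Integration.integrable_bound[OF integrable_lborel_affine[OF _ g, of "r n" x]])
       (use r[of n] nn in \<open>auto intro!: AE_I2 mult_left_le\<close>)
  have JA: "norm (?J x n) \<le> A" for x n
  proof -
    have "norm (?J x n) \<le> (\<integral>\<xi>. norm (cis (x \<bullet> \<xi>) * h \<xi> * complex_of_real (exp (- ((r n)\<^sup>2 / 4) * (norm \<xi>)\<^sup>2))) \<partial>lborel)"
      by (rule integral_norm_bound)
    also have "\<dots> \<le> A"
      unfolding A_def by (rule integral_mono'[OF integrable_norm[OF hi]]) (auto simp: norm_mult intro!: mult_left_le)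
    finally show ?thesis .
  qed
  have Ile: "?I x n \<le> A / c" for x n
  proof -
    have "?I x n \<ge> 0" by (intro integral_nonneg_AE AE_I2) (simp add: nn)
    then have "c * ?I x n = norm (?J x n)" unfolding JI using c by (simp only: norm_of_real) simp
    also have "\<dots> \<le> A" by (rule JA)
    finally show ?thesis using c by (simp add: field_simps)
  qed
  \<comment> \<open>Dominated convergence on the space side needs a bound on \<open>g\<close>, which
    is not among the hypotheses. As \<open>g\<close> is nonnegative, Fatou's lemma applied to the
    averages, all of them at most \<open>A / c\<close>, provides one.\<close>
  obtain B where B: "\<And>x. g x \<le> B"
  proof
    fix x
    have "(\<integral>\<^sup>+z. ennreal (g x * ?e z) \<partial>lborel) = (\<integral>\<^sup>+z. liminf (\<lambda>n. ennreal (g (x + r n *\<^sub>R z) * ?e z)) \<partial>lborel)"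
    proof (intro nn_integral_cong)
      fix z
      have "(\<lambda>n. ennreal (g (x + r n *\<^sub>R z) * ?e z)) \<longlonglongrightarrow> ennreal (g x * ?e z)"
        unfolding r_def by (intro tendsto_intros continuous_sequence_scaled cont)
      then show "ennreal (g x * ?e z) = liminf (\<lambda>n. ennreal (g (x + r n *\<^sub>R z) * ?e z))"
        by (rule lim_imp_Liminf[symmetric, rotated]) simp
    qed
    also have "\<dots> \<le> liminf (\<lambda>n. \<integral>\<^sup>+z. ennreal (g (x + r n *\<^sub>R z) * ?e z) \<partial>lborel)"
      by (rule nn_integral_liminf) simp
    also have "\<dots> \<le> ennreal (A / c)"
    proof (rule Liminf_le, simp, rule always_eventually, intro allI)
      show "(\<integral>\<^sup>+z. ennreal (g (x + r n *\<^sub>R z) * ?e z) \<partial>lborel) \<le> ennreal (A / c)" for n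
        using Ile by (subst nn_integral_eq_integral[OF Ii]) (auto simp: nn intro!: AE_I2 ennreal_leI)
    qed
    finally have "ennreal (g x * sqrt pi ^ DIM('a)) \<le> ennreal (A / c)"
      by (subst (asm) nn_integral_eq_integral) (auto simp: nn ei gaussian_mass)
    then have "g x * sqrt pi ^ DIM('a) \<le> A / c"
      using c by (subst (asm) ennreal_le_iff) (auto simp: A_def)
    then show "g x \<le> A / c / sqrt pi ^ DIM('a)" by (subst pos_le_divide_eq) simp_all
  qed
  have "(\<lambda>n. ?I x n) \<longlonglongrightarrow> (\<integral>z. g x * ?e z \<partial>lborel)"
  proof (rule integral_dominated_convergence[where w = "\<lambda>z. B * ?e z"])
    show "AE z in lborel. (\<lambda>n. g (x + r n *\<^sub>R z) * ?e z) \<longlonglongrightarrow> g x * ?e z"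
      unfolding r_def by (intro AE_I2 tendsto_intros continuous_sequence_scaled cont)
    show "AE z in lborel. norm (g (x + r n *\<^sub>R z) * ?e z) \<le> B * ?e z" for n
      by (intro AE_I2) (auto simp: nn B abs_mult intro!: mult_right_mono)
  qed (use ei in auto)
  then have "(\<lambda>n. complex_of_real (c * ?I x n)) \<longlonglongrightarrow> complex_of_real (c * (g x * sqrt pi ^ DIM('a)))"
    by (intro tendsto_intros) (simp add: gaussian_mass)
  moreover have "c * (g x * sqrt pi ^ DIM('a)) = (2 * pi) ^ DIM('a) * g x"
  proof -
    have "c * sqrt pi ^ DIM('a) = (2 * sqrt pi * sqrt pi) ^ DIM('a)"
      by (simp only: c_def power_mult_distrib)
    moreover have "2 * sqrt pi * sqrt pi = 2 * pi" by simp
    moreover have "c * (g x * sqrt pi ^ DIM('a)) = c * sqrt pi ^ DIM('a) * g x"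
      by (simp only: mult_ac)
    ultimately show ?thesis by simp
  qed
  ultimately have lim1: "(\<lambda>n. ?J x n) \<longlonglongrightarrow> complex_of_real ((2 * pi) ^ DIM('a) * g x)"
    unfolding JI by simp
  have "(\<lambda>n. ?J x n) \<longlonglongrightarrow> (\<integral>\<xi>. cis (x \<bullet> \<xi>) * h \<xi> \<partial>lborel)"
  proof (rule integral_dominated_convergence[where w = "\<lambda>\<xi>. norm (h \<xi>)"])
    show "AE \<xi> in lborel. (\<lambda>n. cis (x \<bullet> \<xi>) * h \<xi> * complex_of_real (exp (- ((r n)\<^sup>2 / 4) * (norm \<xi>)\<^sup>2)))
        \<longlonglongrightarrow> cis (x \<bullet> \<xi>) * h \<xi>"
    proof (intro AE_I2)
      fix \<xi> :: 'a
      have "r \<longlonglongrightarrow> 0" unfolding r_def by (rule LIMSEQ_Suc[OF lim_1_over_n])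
      then have "(\<lambda>n. cis (x \<bullet> \<xi>) * h \<xi> * complex_of_real (exp (- ((r n)\<^sup>2 / 4) * (norm \<xi>)\<^sup>2)))
        \<longlonglongrightarrow> cis (x \<bullet> \<xi>) * h \<xi> * complex_of_real (exp (- (0\<^sup>2 / 4) * (norm \<xi>)\<^sup>2))"
        by (intro tendsto_intros) auto
      then show "(\<lambda>n. cis (x \<bullet> \<xi>) * h \<xi> * complex_of_real (exp (- ((r n)\<^sup>2 / 4) * (norm \<xi>)\<^sup>2)))
        \<longlonglongrightarrow> cis (x \<bullet> \<xi>) * h \<xi>" by simp
    qed
    show "AE \<xi> in lborel. norm (cis (x \<bullet> \<xi>) * h \<xi> * complex_of_real (exp (- ((r n)\<^sup>2 / 4) * (norm \<xi>)\<^sup>2))) \<le> norm (h \<xi>)" for n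
      by (intro AE_I2) (auto simp: norm_mult intro!: mult_left_le)
  qed (use hi in auto)
  from LIMSEQ_unique[OF lim1 this] show ?thesis .
qed

section \<open>Symbols with radially decreasing transform\<close>

definition radially_decreasing :: "('a::euclidean_space \<Rightarrow> real) \<Rightarrow> bool" where
  "radially_decreasing f \<longleftrightarrow> (\<forall>x y. norm x \<le> norm y \<longrightarrow> f y \<le> f x)"

definition cos_transform :: "('a::euclidean_space \<Rightarrow> real) \<Rightarrow> 'a \<Rightarrow> real" where
  "cos_transform h x = (\<integral>\<xi>. cos (x \<bullet> \<xi>) * h \<xi> \<partial>lborel)"

text \<open>The Gaussian factor makes the transform of a bounded symbol absolutely convergent.\<close>

definition radial_symbol :: "('a::euclidean_space \<Rightarrow> real) \<Rightarrow> bool" where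
  "radial_symbol h \<longleftrightarrow> h \<in> borel_measurable borel \<and> bounded (range h) \<and>
     (\<forall>\<delta>>0. radially_decreasing (cos_transform (\<lambda>\<xi>. h \<xi> * exp (- \<delta> * (norm \<xi>)\<^sup>2))))"

text \<open>Symbols are not evidently closed under products, whereas multipliers are, by composition.\<close>

definition radial_multiplier :: "('a::euclidean_space \<Rightarrow> real) \<Rightarrow> bool" where
  "radial_multiplier m \<longleftrightarrow> m \<in> borel_measurable borel \<and> bounded (range m) \<and>
     (\<forall>h. radial_symbol h \<longrightarrow> radial_symbol (\<lambda>\<xi>. m \<xi> * h \<xi>))"

lemma radial_multiplierD: "radial_multiplier m \<Longrightarrow> radial_symbol h \<Longrightarrow> radial_symbol (\<lambda>\<xi>. m \<xi> * h \<xi>)"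
  by (simp add: radial_multiplier_def)

lemma bounded_range_iff: "bounded (range f) \<longleftrightarrow> (\<exists>B. \<forall>x. \<bar>f x\<bar> \<le> B)" for f :: "'a \<Rightarrow> real"
  by (simp add: bounded_iff)

lemma bounded_range_add: "bounded (range f) \<Longrightarrow> bounded (range g) \<Longrightarrow> bounded (range (\<lambda>x. f x + g x))"
  for f g :: "'a \<Rightarrow> real"
  by (rule bounded_plus_comp)

lemma bounded_range_mult:
  fixes f g :: "'a \<Rightarrow> real"
  assumes "bounded (range f)" "bounded (range g)"
  shows "bounded (range (\<lambda>x. f x * g x))"
proof -
  obtain B C where "\<And>x. \<bar>f x\<bar> \<le> B" "\<And>x. \<bar>g x\<bar> \<le> C"
    using assms unfolding bounded_range_iff by auto
  then have "\<bar>f x * g x\<bar> \<le> B * C" for x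
    unfolding abs_mult by (intro mult_mono) (auto intro: order_trans[OF abs_ge_zero])
  then show ?thesis unfolding bounded_range_iff by blast
qed

lemma cos_transform_integrable:
  fixes h :: "'a::euclidean_space \<Rightarrow> real"
  assumes "integrable lborel h"
  shows "integrable lborel (\<lambda>\<xi>. cos (x \<bullet> \<xi>) * h \<xi>)"
proof (rule Bochner_Integration.integrable_bound[OF assms])
  have [measurable]: "h \<in> borel_measurable borel" using assms by simp
  show "(\<lambda>\<xi>. cos (x \<bullet> \<xi>) * h \<xi>) \<in> borel_measurable lborel" by measurable
qed (auto simp: abs_mult intro!: AE_I2 mult_left_le_one_le)

lemma bounded_times_gaussian_integrable:
  fixes h :: "'a::euclidean_space \<Rightarrow> real"
  assumes [measurable]: "h \<in> borel_measurable borel" and "bounded (range h)" and "\<delta> > 0"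
  shows "integrable lborel (\<lambda>\<xi>. h \<xi> * exp (- \<delta> * (norm \<xi>)\<^sup>2))"
proof -
  obtain B where B: "\<And>x. \<bar>h x\<bar> \<le> B" using assms(2) unfolding bounded_range_iff by auto
  then have "B \<ge> 0" using order_trans[OF abs_ge_zero] by blast
  then show ?thesis
    by (intro Bochner_Integration.integrable_bound[OF integrable_mult_right[OF gaussian_integrable[OF assms(3)], of B]])
       (auto simp: abs_mult B intro!: AE_I2 mult_right_mono)
qed

lemma radial_symbol_integrable:
  assumes "radial_symbol h" "\<delta> > 0"
  shows "integrable lborel (\<lambda>\<xi>. cos (x \<bullet> \<xi>) * (h \<xi> * exp (- \<delta> * (norm \<xi>)\<^sup>2)))"
  using assms by (intro cos_transform_integrable bounded_times_gaussian_integrable) (auto simp: radial_symbol_def)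

lemma radially_decreasing_limit:
  assumes "\<And>n. radially_decreasing (f n)" "\<And>x. (\<lambda>n. f n x) \<longlonglongrightarrow> g x"
  shows "radially_decreasing g"
  unfolding radially_decreasing_def
proof (intro allI impI)
  show "g y \<le> g x" if "norm x \<le> norm y" for x y
    by (rule LIMSEQ_le[OF assms(2) assms(2)]) (use assms(1) that in \<open>auto simp: radially_decreasing_def\<close>)
qed

text \<open>The seed: a multiplier yields a statement about a transform only after it has been
  applied to some symbol.\<close>

lemma radial_symbol_1: "radial_symbol (\<lambda>_::'a::euclidean_space. 1)"
  unfolding radial_symbol_def radially_decreasing_def cos_transform_def
proof (intro conjI allI impI)
  fix \<delta> :: real and x y :: 'a assume \<delta>: "\<delta> > 0" and n: "norm x \<le> norm y"
  have "(norm x)\<^sup>2 \<le> (norm y)\<^sup>2" using n by (intro power_mono) auto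
  then have "exp (- (norm y)\<^sup>2 / (4 * \<delta>)) \<le> exp (- (norm x)\<^sup>2 / (4 * \<delta>))"
    using \<delta> by (simp add: divide_right_mono)
  then show "(\<integral>\<xi>. cos (y \<bullet> \<xi>) * (1 * exp (- \<delta> * (norm \<xi>)\<^sup>2)) \<partial>lborel)
    \<le> (\<integral>\<xi>. cos (x \<bullet> \<xi>) * (1 * exp (- \<delta> * (norm \<xi>)\<^sup>2)) \<partial>lborel)"
    using \<delta> by (simp add: gaussian_cos[simplified] mult_left_mono)
qed (auto simp: bounded_range_iff)

text \<open>The factor merely raises the damping parameter from \<delta> to \<delta> + s; this is
  why a symbol is tested with every \<delta> > 0.\<close>

lemma radial_multiplier_gaussian:
  assumes "s \<ge> 0"
  shows "radial_multiplier (\<lambda>\<xi>::'a::euclidean_space. exp (- s * (norm \<xi>)\<^sup>2))"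
  unfolding radial_multiplier_def
proof (intro conjI allI impI)
  show b: "bounded (range (\<lambda>\<xi>::'a. exp (- s * (norm \<xi>)\<^sup>2)))"
    unfolding bounded_range_iff by (rule exI[of _ 1]) (use assms in auto)
  fix h :: "'a \<Rightarrow> real" assume h: "radial_symbol h"
  then have [measurable]: "h \<in> borel_measurable borel" by (simp add: radial_symbol_def)
  have eq: "exp (- s * (norm \<xi>)\<^sup>2) * h \<xi> * exp (- \<delta> * (norm \<xi>)\<^sup>2) = h \<xi> * exp (- (\<delta> + s) * (norm \<xi>)\<^sup>2)"
    for \<xi> :: 'a and \<delta>
    by (simp add: distrib_right exp_diff exp_minus field_simps exp_add)
  show "radial_symbol (\<lambda>\<xi>. exp (- s * (norm \<xi>)\<^sup>2) * h \<xi>)"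
    using h bounded_range_mult[OF b, of h] assms unfolding radial_symbol_def eq by (simp del: minus_add_distrib)
qed simp

section \<open>Closure of radial multipliers under nonnegative combinations, products and
  limits\<close>

lemma radial_multiplier_const:
  assumes "c \<ge> 0"
  shows "radial_multiplier (\<lambda>_::'a::euclidean_space. c)"
  unfolding radial_multiplier_def
proof (intro conjI allI impI)
  fix h :: "'a \<Rightarrow> real" assume h: "radial_symbol h"
  have "cos_transform (\<lambda>\<xi>. c * h \<xi> * exp (- \<delta> * (norm \<xi>)\<^sup>2)) x
      = c * cos_transform (\<lambda>\<xi>. h \<xi> * exp (- \<delta> * (norm \<xi>)\<^sup>2)) x" for \<delta> x
    unfolding cos_transform_def by (subst integral_mult_right_zero[symmetric]) (simp add: mult_ac)
  then show "radial_symbol (\<lambda>\<xi>. c * h \<xi>)"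
    using h assms unfolding radial_symbol_def radially_decreasing_def
    by (auto intro!: mult_left_mono bounded_range_mult)
qed (auto simp: bounded_range_iff)

lemma radial_multiplier_add:
  fixes m n :: "'a::euclidean_space \<Rightarrow> real"
  assumes m: "radial_multiplier m" and n: "radial_multiplier n"
  shows "radial_multiplier (\<lambda>\<xi>. m \<xi> + n \<xi>)"
  unfolding radial_multiplier_def
proof (intro conjI allI impI)
  fix h :: "'a \<Rightarrow> real" assume h: "radial_symbol h"
  have mh: "radial_symbol (\<lambda>\<xi>. m \<xi> * h \<xi>)" and nh: "radial_symbol (\<lambda>\<xi>. n \<xi> * h \<xi>)"
    using m n h by (auto simp: radial_multiplier_def)
  have "cos_transform (\<lambda>\<xi>. (m \<xi> + n \<xi>) * h \<xi> * exp (- \<delta> * (norm \<xi>)\<^sup>2)) x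
      = cos_transform (\<lambda>\<xi>. m \<xi> * h \<xi> * exp (- \<delta> * (norm \<xi>)\<^sup>2)) x
      + cos_transform (\<lambda>\<xi>. n \<xi> * h \<xi> * exp (- \<delta> * (norm \<xi>)\<^sup>2)) x" if "\<delta> > 0" for \<delta> x
    unfolding cos_transform_def
    by (subst Bochner_Integration.integral_add[OF radial_symbol_integrable[OF mh that] radial_symbol_integrable[OF nh that], symmetric])
       (simp add: algebra_simps)
  moreover have "bounded (range (\<lambda>\<xi>. (m \<xi> + n \<xi>) * h \<xi>))" "(\<lambda>\<xi>. (m \<xi> + n \<xi>) * h \<xi>) \<in> borel_measurable borel"
    using h m n by (auto simp: radial_symbol_def radial_multiplier_def intro!: bounded_range_mult bounded_range_add)
  ultimately show "radial_symbol (\<lambda>\<xi>. (m \<xi> + n \<xi>) * h \<xi>)"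
    using mh nh unfolding radial_symbol_def radially_decreasing_def by (auto intro!: add_mono)
qed (use m n in \<open>auto simp: radial_multiplier_def intro: bounded_range_add\<close>)

lemma radial_multiplier_mult:
  fixes m n :: "'a::euclidean_space \<Rightarrow> real"
  assumes "radial_multiplier m" "radial_multiplier n"
  shows "radial_multiplier (\<lambda>\<xi>. m \<xi> * n \<xi>)"
  using assms unfolding radial_multiplier_def
  by (auto intro: bounded_range_mult simp: mult.assoc)

lemma radial_multiplier_power:
  "radial_multiplier m \<Longrightarrow> radial_multiplier (\<lambda>\<xi>. m \<xi> ^ k)"
  by (induction k) (auto intro: radial_multiplier_const radial_multiplier_mult)

lemma radial_multiplier_sum:
  "(\<And>i. i \<in> I \<Longrightarrow> radial_multiplier (m i)) \<Longrightarrow> radial_multiplier (\<lambda>\<xi>. \<Sum>i\<in>I. m i \<xi>)"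
  by (induction I rule: infinite_finite_induct) (auto intro: radial_multiplier_const radial_multiplier_add)

text \<open>Gaussian damping makes a uniform bound sufficient for dominated convergence. The origin,
  a null set, is exempt because the binomial series applied later is available only for |z| < 1,
  while the Gaussian equals 1 there.\<close>

lemma radial_multiplier_limit:
  fixes m :: "'a::euclidean_space \<Rightarrow> real"
  assumes F: "\<And>n. radial_multiplier (F n)" and m[measurable]: "m \<in> borel_measurable borel"
    and bF: "\<And>n \<xi>. \<xi> \<noteq> 0 \<Longrightarrow> \<bar>F n \<xi>\<bar> \<le> B" and bm: "\<And>\<xi>. \<bar>m \<xi>\<bar> \<le> B"
    and lim: "\<And>\<xi>. \<xi> \<noteq> 0 \<Longrightarrow> (\<lambda>n. F n \<xi>) \<longlonglongrightarrow> m \<xi>"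
  shows "radial_multiplier m"
  unfolding radial_multiplier_def
proof (intro conjI allI impI)
  show b: "bounded (range m)" using bm by (auto simp: bounded_range_iff)
  fix h :: "'a \<Rightarrow> real" assume h: "radial_symbol h"
  then have [measurable]: "h \<in> borel_measurable borel" and bh: "bounded (range h)" by (auto simp: radial_symbol_def)
  have [measurable]: "F n \<in> borel_measurable borel" for n using F by (auto simp: radial_multiplier_def)
  have "radially_decreasing (cos_transform (\<lambda>\<xi>. m \<xi> * h \<xi> * exp (- \<delta> * (norm \<xi>)\<^sup>2)))" if \<delta>: "\<delta> > 0" for \<delta>
  proof (rule radially_decreasing_limit)
    show "radially_decreasing (cos_transform (\<lambda>\<xi>. F n \<xi> * h \<xi> * exp (- \<delta> * (norm \<xi>)\<^sup>2)))" for n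
      using F[of n] h \<delta> unfolding radial_multiplier_def radial_symbol_def by auto
    fix x
    have i: "integrable lborel (\<lambda>\<xi>. B * \<bar>h \<xi> * exp (- \<delta> * (norm \<xi>)\<^sup>2)\<bar>)"
      using bounded_times_gaussian_integrable[OF _ bh \<delta>] by (intro integrable_mult_right integrable_abs) auto
    have ne: "AE \<xi>::'a in lborel. \<xi> \<noteq> 0" by (rule AE_lborel_singleton)
    show "(\<lambda>n. cos_transform (\<lambda>\<xi>. F n \<xi> * h \<xi> * exp (- \<delta> * (norm \<xi>)\<^sup>2)) x)
        \<longlonglongrightarrow> cos_transform (\<lambda>\<xi>. m \<xi> * h \<xi> * exp (- \<delta> * (norm \<xi>)\<^sup>2)) x"
      unfolding cos_transform_def
    proof (rule integral_dominated_convergence[OF _ _ i])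
      show "AE \<xi> in lborel. (\<lambda>n. cos (x \<bullet> \<xi>) * (F n \<xi> * h \<xi> * exp (- \<delta> * (norm \<xi>)\<^sup>2)))
          \<longlonglongrightarrow> cos (x \<bullet> \<xi>) * (m \<xi> * h \<xi> * exp (- \<delta> * (norm \<xi>)\<^sup>2))"
        using ne by eventually_elim (intro tendsto_intros lim)
      show "AE \<xi> in lborel. norm (cos (x \<bullet> \<xi>) * (F n \<xi> * h \<xi> * exp (- \<delta> * (norm \<xi>)\<^sup>2)))
          \<le> B * \<bar>h \<xi> * exp (- \<delta> * (norm \<xi>)\<^sup>2)\<bar>" for n
        using ne
      proof eventually_elim
        case (elim \<xi>)
        have "\<bar>cos (x \<bullet> \<xi>)\<bar> * (\<bar>F n \<xi>\<bar> * (\<bar>h \<xi>\<bar> * exp (- \<delta> * (norm \<xi>)\<^sup>2))) \<le> 1 * (B * (\<bar>h \<xi>\<bar> * exp (- \<delta> * (norm \<xi>)\<^sup>2)))"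
          by (intro mult_mono bF[OF elim]) (auto intro: order_trans[OF abs_ge_zero bF[OF elim]])
        then show ?case by (simp add: abs_mult mult.assoc)
      qed
    qed measurable
  qed
  then show "radial_symbol (\<lambda>\<xi>. m \<xi> * h \<xi>)"
    unfolding radial_symbol_def using bounded_range_mult[OF b bh] by auto
qed simp

text \<open>The exponential series has nonnegative coefficients, so its partial sums are
  multipliers, and a bound of \<open>m\<close> bounds them uniformly.\<close>

lemma radial_multiplier_exp:
  fixes m :: "'a::euclidean_space \<Rightarrow> real"
  assumes m: "radial_multiplier m"
  shows "radial_multiplier (\<lambda>\<xi>. exp (m \<xi>))"
proof -
  obtain B where B: "\<And>\<xi>. \<bar>m \<xi>\<bar> \<le> B" using m by (auto simp: radial_multiplier_def bounded_range_iff)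
  have [measurable]: "m \<in> borel_measurable borel" using m by (auto simp: radial_multiplier_def)
  show ?thesis
  proof (rule radial_multiplier_limit[where F = "\<lambda>n \<xi>. \<Sum>k<n. inverse (fact k) * m \<xi> ^ k" and B = "exp B"])
    show "radial_multiplier (\<lambda>\<xi>. \<Sum>k<n. inverse (fact k) * m \<xi> ^ k)" for n
      by (intro radial_multiplier_sum radial_multiplier_mult radial_multiplier_const radial_multiplier_power m) auto
    have s: "(\<lambda>k. inverse (fact k) * y ^ k) sums exp y" for y :: real
      using exp_converges[of y] by (simp add: divide_inverse mult.commute)
    show "(\<lambda>n. \<Sum>k<n. inverse (fact k) * m \<xi> ^ k) \<longlonglongrightarrow> exp (m \<xi>)" for \<xi>
      using s[of "m \<xi>"] by (simp add: sums_def)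
    show "\<bar>\<Sum>k<n. inverse (fact k) * m \<xi> ^ k\<bar> \<le> exp B" for n \<xi>
    proof -
      have "\<bar>\<Sum>k<n. inverse (fact k) * m \<xi> ^ k\<bar> \<le> (\<Sum>k<n. inverse (fact k) * B ^ k)"
        using B[of \<xi>] by (intro order_trans[OF sum_abs] sum_mono)
          (auto simp: abs_mult power_abs intro!: mult_left_mono power_mono)
      also have "\<dots> \<le> (\<Sum>k. inverse (fact k) * B ^ k)"
        using order_trans[OF abs_ge_zero B] s[of B] by (intro sum_le_suminf) (auto simp: sums_iff)
      finally show ?thesis using s[of B] by (simp add: sums_iff)
    qed
    show "\<bar>exp (m \<xi>)\<bar> \<le> exp B" for \<xi> using B[of \<xi>] by simp
  qed simp
qed

section \<open>From Gaussians to exp(-t |\<xi>|^\<theta>)\<close>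

text \<open>The first term is -\<alpha>, and consecutive terms have the ratio (k + 1 - \<alpha>) /
  (k + 2), which is nonnegative as \<alpha> \<le> 1.\<close>

lemma gchoose_alternating_sign:
  fixes \<alpha> :: real
  assumes "0 < \<alpha>" "\<alpha> \<le> 1"
  shows "(\<alpha> gchoose Suc k) * (- 1) ^ Suc k \<le> 0"
proof (induction k)
  case (Suc k)
  have "(\<alpha> gchoose Suc (Suc k)) = (\<alpha> gchoose Suc k) * (\<alpha> - real (Suc k)) / real (Suc (Suc k))"
    using gbinomial_mult_1[of \<alpha> "Suc k"] by (simp add: field_simps del: gbinomial_Suc of_nat_Suc)
  then have "(\<alpha> gchoose Suc (Suc k)) * (- 1) ^ Suc (Suc k)
    = ((\<alpha> gchoose Suc k) * (- 1) ^ Suc k) * ((real (Suc k) - \<alpha>) / real (Suc (Suc k)))"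
    by (simp only: power_Suc[of _ "Suc k"]) (simp add: divide_simps del: power_Suc, simp add: algebra_simps)
  also have "\<dots> \<le> 0" by (rule mult_nonpos_nonneg[OF Suc]) (use assms in auto)
  finally show ?case .
qed (use assms in auto)

lemma radial_multiplier_binomial:
  assumes \<alpha>: "0 < \<alpha>" "\<alpha> \<le> 1" and s: "s > 0"
  shows "radial_multiplier (\<lambda>\<xi>::'a::euclidean_space. 1 - (1 - exp (- s * (norm \<xi>)\<^sup>2)) powr \<alpha>)"
proof -
  \<comment> \<open>The term of index 0 of the binomial series cancels against the leading 1; what
    remains are the shifted coefficients with reversed sign, hence nonnegative ones.\<close>
  define a where "a k = - ((\<alpha> gchoose Suc k) * (- 1) ^ Suc k)" for k
  have a: "a k \<ge> 0" for k using gchoose_alternating_sign[OF \<alpha>, of k] by (simp add: a_def)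
  let ?z = "\<lambda>\<xi>::'a. exp (- s * (norm \<xi>)\<^sup>2)"
  have sums: "(\<lambda>k. a k * z ^ Suc k) sums (1 - (1 - z) powr \<alpha>)" if "0 \<le> z" "z < 1" for z
  proof -
    have "(\<lambda>n. (\<alpha> gchoose n) * (- z) ^ n) sums (1 - z) powr \<alpha>"
      using gen_binomial_real[of "- z" \<alpha>] that by simp
    then have "(\<lambda>n. (\<alpha> gchoose Suc n) * (- z) ^ Suc n) sums ((1 - z) powr \<alpha> - 1)"
      by (subst sums_Suc_iff) simp
    from sums_minus[OF this] show ?thesis
      by (simp add: a_def power_minus[of z] mult_ac)
  qed
  show ?thesis
  proof (rule radial_multiplier_limit[where F = "\<lambda>n \<xi>. \<Sum>k<n. a k * ?z \<xi> ^ Suc k" and B = 1])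
    show "radial_multiplier (\<lambda>\<xi>. \<Sum>k<n. a k * ?z \<xi> ^ Suc k)" for n
      using s a by (intro radial_multiplier_sum radial_multiplier_mult radial_multiplier_const
        radial_multiplier_power radial_multiplier_gaussian) auto
    fix \<xi> :: 'a
    have 1: "0 \<le> (1 - ?z \<xi>) powr \<alpha>" "(1 - ?z \<xi>) powr \<alpha> \<le> 1"
      using s \<alpha> by (auto intro!: powr_le1)
    then show "\<bar>1 - (1 - ?z \<xi>) powr \<alpha>\<bar> \<le> 1" by linarith
    assume "\<xi> \<noteq> 0"
    then have z: "0 \<le> ?z \<xi>" "?z \<xi> < 1" using s by auto
    show "(\<lambda>n. \<Sum>k<n. a k * ?z \<xi> ^ Suc k) \<longlonglongrightarrow> 1 - (1 - ?z \<xi>) powr \<alpha>"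
      using sums[OF z] by (simp only: sums_def)
    fix n
    \<comment> \<open>As no term is negative, partial sums stay below the full sum, which is at most
      1. This is uniform in n and needs no estimate of the coefficients.\<close>
    have "(\<Sum>k<n. a k * ?z \<xi> ^ Suc k) \<le> (\<Sum>k. a k * ?z \<xi> ^ Suc k)"
      using sums[OF z] a by (intro sum_le_suminf) (auto simp: sums_iff)
    also have "\<dots> \<le> 1" using sums[OF z] 1 by (simp add: sums_iff)
    finally show "\<bar>\<Sum>k<n. a k * ?z \<xi> ^ Suc k\<bar> \<le> 1"
      using a by (subst abs_of_nonneg) (auto intro!: sum_nonneg mult_nonneg_nonneg)
  qed measurable
qed

lemma radial_multiplier_exp_neg_powr:
  assumes \<theta>: "0 < \<theta>" "\<theta> \<le> 2" and t: "t \<ge> 0"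
  shows "radial_multiplier (\<lambda>\<xi>::'a::euclidean_space. exp (- t * norm \<xi> powr \<theta>))"
proof -
  define \<alpha> where "\<alpha> = \<theta> / 2"
  have \<alpha>: "0 < \<alpha>" "\<alpha> \<le> 1" using \<theta> by (auto simp: \<alpha>_def)
  define s where "s n = 1 / real (Suc n)" for n
  have s: "s n > 0" for n by (simp add: s_def)
  let ?w = "\<lambda>n \<xi>::'a. (1 - exp (- s n * (norm \<xi>)\<^sup>2)) powr \<alpha>"
  let ?c = "\<lambda>n. t * (1 / s n) powr \<alpha>"
  show ?thesis
  \<comment> \<open>Splitting off exp(-c_n) lets the multiplier 1 - w_n enter the exponential with a
    nonnegative coefficient; the closure rules do not apply to -c_n w_n directly.\<close>
  proof (rule radial_multiplier_limit[where F = "\<lambda>n \<xi>. exp (- ?c n) * exp (?c n * (1 - ?w n \<xi>))" and B = 1])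
    show "radial_multiplier (\<lambda>\<xi>. exp (- ?c n) * exp (?c n * (1 - ?w n \<xi>)))" for n
      using t s[of n] by (intro radial_multiplier_mult radial_multiplier_exp radial_multiplier_const
        radial_multiplier_binomial \<alpha>) auto
    have F: "exp (- ?c n) * exp (?c n * (1 - ?w n \<xi>)) = exp (- t * ((1 - exp (- s n * (norm \<xi>)\<^sup>2)) / s n) powr \<alpha>)" for n \<xi>
    proof -
      have "((1 - exp (- s n * (norm \<xi>)\<^sup>2)) / s n) powr \<alpha> = (1 / s n) powr \<alpha> * ?w n \<xi>"
        using s[of n] by (subst powr_mult[symmetric]) (auto simp: field_simps)
      then show ?thesis by (simp add: exp_add[symmetric] algebra_simps)
    qed
    show "\<bar>exp (- ?c n) * exp (?c n * (1 - ?w n \<xi>))\<bar> \<le> 1" for n \<xi>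
      unfolding F using t by simp
    show "\<bar>exp (- t * norm \<xi> powr \<theta>)\<bar> \<le> 1" for \<xi> :: 'a using t by simp
    fix \<xi> :: 'a assume "\<xi> \<noteq> 0"
    then have l: "(norm \<xi>)\<^sup>2 > 0" by simp
    have "((\<lambda>r. (1 - exp (- r * L)) / r) \<longlongrightarrow> L) (at_right 0)" if "L > 0" for L :: real
      using that by real_asymp
    moreover have "filterlim s (at_right 0) sequentially"
      unfolding s_def by real_asymp
    ultimately have "(\<lambda>n. (1 - exp (- s n * (norm \<xi>)\<^sup>2)) / s n) \<longlonglongrightarrow> (norm \<xi>)\<^sup>2"
      using l filterlim_compose by blast
    then have "(\<lambda>n. exp (- t * ((1 - exp (- s n * (norm \<xi>)\<^sup>2)) / s n) powr \<alpha>)) \<longlonglongrightarrow> exp (- t * ((norm \<xi>)\<^sup>2) powr \<alpha>)"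
      using l by (intro tendsto_intros) auto
    moreover have "((norm \<xi>)\<^sup>2) powr \<alpha> = norm \<xi> powr \<theta>"
      using \<open>\<xi> \<noteq> 0\<close> by (simp add: \<alpha>_def powr_powr flip: powr_numeral)
    ultimately show "(\<lambda>n. exp (- ?c n) * exp (?c n * (1 - ?w n \<xi>))) \<longlonglongrightarrow> exp (- t * norm \<xi> powr \<theta>)"
      unfolding F by simp
  qed measurable
qed

text \<open>The multiplier applied to the constant symbol 1 gives monotonicity under each Gaussian
  damping; since the symbol is integrable, the damping can be removed in the limit.\<close>

theorem radially_decreasing_cos_transform_exp_neg_powr:
  assumes \<theta>: "0 < \<theta>" "\<theta> \<le> 2" and t: "t > 0"
  shows "radially_decreasing (cos_transform (\<lambda>\<xi>::'a::euclidean_space. exp (- t * norm \<xi> powr \<theta>)))"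
proof (rule radially_decreasing_limit)
  define s where "s n = 1 / real (Suc n)" for n
  have s: "s n > 0" for n by (simp add: s_def)
  have s0: "s \<longlonglongrightarrow> 0" unfolding s_def by (rule LIMSEQ_Suc[OF lim_1_over_n])
  let ?h = "\<lambda>\<xi>::'a. exp (- t * norm \<xi> powr \<theta>)"
  have "radial_symbol (\<lambda>\<xi>. ?h \<xi> * 1)"
    by (rule radial_multiplierD[OF radial_multiplier_exp_neg_powr[OF \<theta>] radial_symbol_1]) (use t in simp)
  then show "radially_decreasing (cos_transform (\<lambda>\<xi>. ?h \<xi> * exp (- s n * (norm \<xi>)\<^sup>2)))" for n
    using s[of n] by (simp add: radial_symbol_def)
  fix x :: 'a
  show "(\<lambda>n. cos_transform (\<lambda>\<xi>. ?h \<xi> * exp (- s n * (norm \<xi>)\<^sup>2)) x) \<longlonglongrightarrow> cos_transform ?h x"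
    unfolding cos_transform_def
  proof (rule integral_dominated_convergence[OF _ _ exp_neg_powr_integrable[OF t \<theta>(1)]])
    show "AE \<xi> in lborel. (\<lambda>n. cos (x \<bullet> \<xi>) * (?h \<xi> * exp (- s n * (norm \<xi>)\<^sup>2))) \<longlonglongrightarrow> cos (x \<bullet> \<xi>) * ?h \<xi>"
    proof (intro AE_I2)
      fix \<xi> :: 'a
      have "(\<lambda>n. cos (x \<bullet> \<xi>) * (?h \<xi> * exp (- s n * (norm \<xi>)\<^sup>2))) \<longlonglongrightarrow> cos (x \<bullet> \<xi>) * (?h \<xi> * exp (- 0 * (norm \<xi>)\<^sup>2))"
        by (intro tendsto_intros s0)
      then show "(\<lambda>n. cos (x \<bullet> \<xi>) * (?h \<xi> * exp (- s n * (norm \<xi>)\<^sup>2))) \<longlonglongrightarrow> cos (x \<bullet> \<xi>) * ?h \<xi>" by simp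
    qed
    show "AE \<xi> in lborel. norm (cos (x \<bullet> \<xi>) * (?h \<xi> * exp (- s n * (norm \<xi>)\<^sup>2))) \<le> ?h \<xi>" for n
    proof (intro AE_I2)
      fix \<xi> :: 'a
      have "\<bar>cos (x \<bullet> \<xi>)\<bar> * (?h \<xi> * exp (- s n * (norm \<xi>)\<^sup>2)) \<le> 1 * (?h \<xi> * 1)"
        using s[of n] by (intro mult_mono) auto
      then show "norm (cos (x \<bullet> \<xi>) * (?h \<xi> * exp (- s n * (norm \<xi>)\<^sup>2))) \<le> ?h \<xi>"
        by (simp add: abs_mult)
    qed
  qed measurable
qed

section \<open>The fractional heat kernel\<close>

locale fractional_heat_kernel =
  fixes G :: "'a::euclidean_space \<Rightarrow> real \<Rightarrow> real" and \<theta> :: real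
  assumes \<theta>: "0 < \<theta>" "\<theta> \<le> 2" and fundamental: "fundamental_solution \<theta> G"
begin

lemma kernel_pos: "t > 0 \<Longrightarrow> G x t > 0"
  using fundamental by (simp add: fundamental_solution_def)

lemma kernel_continuous: "continuous_on (UNIV \<times> {0<..}) (\<lambda>(x, t). G x t)"
proof -
  have "Ck_on 0 (UNIV \<times> {0<..}) (\<lambda>(x, t). G x t)"
    using fundamental unfolding fundamental_solution_def smooth_on_def by blast
  then show ?thesis by simp
qed

lemma kernel_continuous_space: "t > 0 \<Longrightarrow> continuous_on UNIV (\<lambda>x. G x t)"
proof -
  assume t: "t > 0"
  have "continuous_on UNIV (\<lambda>x. case (x, t) of (x, t) \<Rightarrow> G x t)"
    by (rule continuous_on_compose2[OF kernel_continuous]) (use t in \<open>auto intro!: continuous_intros\<close>)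
  then show ?thesis by simp
qed

lemma kernel_borel_measurable_space: "t > 0 \<Longrightarrow> (\<lambda>x. G x t) \<in> borel_measurable borel"
  by (intro borel_measurable_continuous_onI kernel_continuous_space)

text \<open>Nothing is known about \<open>G\<close> at nonpositive times, so joint measurability is
  stated for the extension by 0.\<close>

lemma kernel_borel_measurable:
  "(\<lambda>z. if snd z > 0 then G (fst z) (snd z) else 0) \<in> borel_measurable borel"
proof -
  have "(\<lambda>z. indicator (UNIV \<times> {0<..}) z *\<^sub>R (case z of (x, t) \<Rightarrow> G x t)) \<in> borel_measurable borel"
    by (intro borel_measurable_continuous_on_indicator kernel_continuous) (simp add: borel_prod[symmetric])
  also have "(\<lambda>z. indicator (UNIV \<times> {0<..}) z *\<^sub>R (case z of (x, t) \<Rightarrow> G x t))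
      = (\<lambda>z. if snd z > 0 then G (fst z) (snd z) else 0)"
    by (auto simp: fun_eq_iff indicator_def)
  finally show ?thesis .
qed

lemma kernel_integrable: "t > 0 \<Longrightarrow> integrable lborel (\<lambda>x. G x t)"
  using fundamental by (simp add: fundamental_solution_def)

lemma kernel_fourier:
  assumes "t > 0"
  shows "(\<integral>y. complex_of_real (G y t) * cis (- (\<xi> \<bullet> y)) \<partial>lborel) = complex_of_real (exp (- t * norm \<xi> powr \<theta>))"
  using fundamental assms by (simp add: fundamental_solution_def cis_conv_exp)

lemma kernel_inversion:
  assumes "t > 0"
  shows "complex_of_real ((2 * pi) ^ DIM('a) * G x t)
       = (\<integral>\<xi>. cis (x \<bullet> \<xi>) * complex_of_real (exp (- t * norm \<xi> powr \<theta>)) \<partial>lborel)"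
proof (rule fourier_inversion[OF kernel_continuous_space[OF assms] _ kernel_integrable[OF assms]])
  show "integrable lborel (\<lambda>\<xi>::'a. complex_of_real (exp (- t * norm \<xi> powr \<theta>)))"
    by (intro integrable_of_real exp_neg_powr_integrable assms \<theta>)
qed (use kernel_fourier[OF assms] kernel_pos[OF assms] in \<open>auto intro: less_imp_le\<close>)

lemma kernel_eq_cos_transform:
  assumes "t > 0"
  shows "(2 * pi) ^ DIM('a) * G x t = cos_transform (\<lambda>\<xi>. exp (- t * norm \<xi> powr \<theta>)) x"
proof -
  let ?h = "\<lambda>\<xi>. cis (x \<bullet> \<xi>) * complex_of_real (exp (- t * norm \<xi> powr \<theta>))"
  have "integrable lborel ?h"
    by (rule Bochner_Integration.integrable_bound[OF exp_neg_powr_integrable[OF assms \<theta>(1)]])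
       (auto simp: norm_mult)
  then have "Re (\<integral>\<xi>. ?h \<xi> \<partial>lborel) = (\<integral>\<xi>. Re (?h \<xi>) \<partial>lborel)" by (rule integral_Re[symmetric])
  then show ?thesis
    unfolding kernel_inversion[OF assms, symmetric] by (simp add: cos_transform_def)
qed

lemma kernel_radially_decreasing:
  assumes "t > 0" "norm x \<le> norm y"
  shows "G y t \<le> G x t"
proof -
  have "(2 * pi) ^ DIM('a) * G y t \<le> (2 * pi) ^ DIM('a) * G x t"
    unfolding kernel_eq_cos_transform[OF assms(1)]
    using radially_decreasing_cos_transform_exp_neg_powr[OF \<theta> assms(1), where 'a = 'a] assms(2)
    unfolding radially_decreasing_def by blast
  then show ?thesis by simp
qed

lemma kernel_mass:
  assumes "t > 0"
  shows "(\<integral>\<^sup>+x. ennreal (G x t) \<partial>lborel) = 1"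
proof -
  \<comment> \<open>Frequency 0: the exponent vanishes because \<open>0 powr \<theta>\<close> is
    0.\<close>
  have "complex_of_real (\<integral>y. G y t \<partial>lborel) = 1"
    using kernel_fourier[OF assms, of 0] by (simp add: integral_complex_of_real)
  then have "(\<integral>y. G y t \<partial>lborel) = 1" by (simp only: of_real_eq_1_iff)
  then show ?thesis
    using assms by (subst nn_integral_eq_integral) (auto intro!: kernel_integrable AE_I2 less_imp_le kernel_pos)
qed

lemma kernel_bound:
  obtains C where "C \<ge> 0" "\<And>x t. t > 0 \<Longrightarrow> G x t \<le> C * t powr (- (real DIM('a) / \<theta>))"
proof
  define E where "E t = (\<integral>(\<xi>::'a). exp (- t * norm \<xi> powr \<theta>) \<partial>lborel)" for t
  have int: "integrable lborel (\<lambda>\<xi>::'a. exp (- t * norm \<xi> powr \<theta>))" if "t > 0" for t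
    using that \<theta> by (intro exp_neg_powr_integrable) auto
  have En: "ennreal (E t) = (\<integral>\<^sup>+(\<xi>::'a). ennreal (exp (- t * norm \<xi> powr \<theta>)) \<partial>lborel)" if "t > 0" for t
    unfolding E_def by (rule nn_integral_eq_integral[symmetric]) (use int[OF that] in auto)
  have E0: "E t \<ge> 0" for t by (simp add: E_def)
  have Es: "E t = t powr (- (real DIM('a) / \<theta>)) * E 1" if "t > 0" for t
  proof -
    have "ennreal (E t) = ennreal (t powr (- (real DIM('a) / \<theta>)) * E 1)"
      using integral_exp_neg_powr_scaling[OF that \<theta>(1), where 'a = 'a] that E0[of 1]
      by (simp add: En ennreal_mult'' En[of 1, simplified])
    then show ?thesis using E0 by (subst (asm) ennreal_inj) auto
  qed
  show "E 1 / (2 * pi) ^ DIM('a) \<ge> 0" using E0[of 1] by simp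
  fix x and t :: real assume t: "t > 0"
  have "(2 * pi) ^ DIM('a) * G x t \<le> E t"
    unfolding kernel_eq_cos_transform[OF t] cos_transform_def E_def
    by (rule integral_mono[OF cos_transform_integrable[OF int[OF t]] int[OF t]]) simp
  then show "G x t \<le> E 1 / (2 * pi) ^ DIM('a) * t powr (- (real DIM('a) / \<theta>))"
    unfolding Es[OF t] by (simp add: field_simps)
qed

text \<open>Only the factor at x - y is represented by inversion. Exchanging the order leaves the
  Fourier transform of the other factor, the two exponentials multiply to the symbol at time t + s,
  and inversion is then read backwards.\<close>

lemma kernel_semigroup_at_0:
  assumes t: "t > 0" and s: "s > 0"
  shows "integrable lborel (\<lambda>y. G (x - y) t * G y s)"
    and "(\<integral>y. G (x - y) t * G y s \<partial>lborel) = G x (t + s)"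
proof -
  have [measurable]: "(\<lambda>x. G x t) \<in> borel_measurable borel" "(\<lambda>x. G x s) \<in> borel_measurable borel"
    using t s by (auto intro: kernel_borel_measurable_space)
  have [measurable]: "(\<lambda>y. G (x - y) t) \<in> borel_measurable borel"
    by (rule measurable_compose[of "\<lambda>y. x - y" borel borel "\<lambda>x. G x t"]) measurable
  have G0: "G z t \<ge> 0" "G z s \<ge> 0" for z using kernel_pos t s by (auto intro: less_imp_le)
  obtain C where C: "C \<ge> 0" "\<And>x t. t > 0 \<Longrightarrow> G x t \<le> C * t powr (- (real DIM('a) / \<theta>))"
    using kernel_bound by blast
  show "integrable lborel (\<lambda>y. G (x - y) t * G y s)"
    by (rule Bochner_Integration.integrable_bound[OF integrable_mult_right[OF kernel_integrable[OF s], of "C * t powr (- (real DIM('a) / \<theta>))"]])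
       (use C t G0 in \<open>auto intro!: AE_I2 mult_right_mono simp: abs_mult\<close>)
  let ?e = "\<lambda>t \<xi>::'a. complex_of_real (exp (- t * norm \<xi> powr \<theta>))"
  let ?k = "\<lambda>y \<xi>. complex_of_real (G y s) * (cis ((x - y) \<bullet> \<xi>) * ?e t \<xi>)"
  have km: "(\<lambda>(y, \<xi>). ?k y \<xi>) \<in> borel_measurable (lborel \<Otimes>\<^sub>M lborel)"
    unfolding split_beta' by measurable
  have kI: "integrable (lborel \<Otimes>\<^sub>M lborel) (\<lambda>(y, \<xi>). ?k y \<xi>)"
    by (rule integrable_product_lborel[OF
          integrable_of_real[OF kernel_integrable[OF s]]
          integrable_of_real[OF exp_neg_powr_integrable[OF t \<theta>(1)]] km])
       (simp add: norm_mult)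
  have cis_split: "cis ((x - y) \<bullet> \<xi>) = cis (x \<bullet> \<xi>) * cis (- (\<xi> \<bullet> y))" for y \<xi>
    by (simp add: cis_mult inner_diff_left inner_commute[of \<xi>])
  have "complex_of_real ((2 * pi) ^ DIM('a) * (\<integral>y. G (x - y) t * G y s \<partial>lborel))
      = (\<integral>y. complex_of_real (G y s) * complex_of_real ((2 * pi) ^ DIM('a) * G (x - y) t) \<partial>lborel)"
    by (subst integral_mult_right_zero[symmetric], subst integral_complex_of_real[symmetric])
       (simp add: mult_ac)
  also have "\<dots> = (\<integral>y. (\<integral>\<xi>. ?k y \<xi> \<partial>lborel) \<partial>lborel)"
    by (simp only: kernel_inversion[OF t] integral_mult_right_zero)
  also have "\<dots> = (\<integral>\<xi>. (\<integral>y. ?k y \<xi> \<partial>lborel) \<partial>lborel)"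
    by (rule lborel_pair.Fubini_integral[symmetric, OF kI])
  also have "\<dots> = (\<integral>\<xi>. cis (x \<bullet> \<xi>) * ?e (t + s) \<xi> \<partial>lborel)"
  proof (intro Bochner_Integration.integral_cong refl)
    fix \<xi> :: 'a
    have "(\<integral>y. ?k y \<xi> \<partial>lborel)
        = (\<integral>y. (cis (x \<bullet> \<xi>) * ?e t \<xi>) * (complex_of_real (G y s) * cis (- (\<xi> \<bullet> y))) \<partial>lborel)"
      by (intro Bochner_Integration.integral_cong refl) (simp only: cis_split mult_ac)
    also have "\<dots> = cis (x \<bullet> \<xi>) * ?e t \<xi> * ?e s \<xi>"
      by (simp only: integral_mult_right_zero kernel_fourier[OF s])
    also have "\<dots> = cis (x \<bullet> \<xi>) * ?e (t + s) \<xi>"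
      by (simp add: ring_distribs exp_add exp_diff exp_minus field_simps)
    finally show "(\<integral>y. ?k y \<xi> \<partial>lborel) = cis (x \<bullet> \<xi>) * ?e (t + s) \<xi>" .
  qed
  also have "\<dots> = complex_of_real ((2 * pi) ^ DIM('a) * G x (t + s))"
    using t s by (subst kernel_inversion) auto
  finally show "(\<integral>y. G (x - y) t * G y s \<partial>lborel) = G x (t + s)"
    by (simp only: of_real_eq_iff mult_cancel_left) simp
qed

lemma kernel_semigroup:
  assumes t: "t > 0" and s: "s > 0"
  shows "(\<integral>\<^sup>+y. ennreal (G (x - y) t) * ennreal (G (y - z) s) \<partial>lborel) = ennreal (G (x - z) (t + s))"
proof -
  have [measurable]: "(\<lambda>x. G x t) \<in> borel_measurable borel" "(\<lambda>x. G x s) \<in> borel_measurable borel"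
    using t s by (auto intro: kernel_borel_measurable_space)
  have [measurable]: "(\<lambda>y. G (x - y) t) \<in> borel_measurable borel"
    by (rule measurable_compose[of "\<lambda>y. x - y" borel borel "\<lambda>x. G x t"]) measurable
  have [measurable]: "(\<lambda>y. G (y - z) s) \<in> borel_measurable borel"
    by (rule measurable_compose[of "\<lambda>y. y - z" borel borel "\<lambda>x. G x s"]) measurable
  have "(\<integral>\<^sup>+y. ennreal (G (x - y) t) * ennreal (G (y - z) s) \<partial>lborel)
      = (\<integral>\<^sup>+y. ennreal (G ((x - z) - y) t * G y s) \<partial>lborel)"
    using t s by (subst nn_integral_lborel_affine[of 1 _ z])
      (auto simp: ennreal_mult kernel_pos less_imp_le algebra_simps)
  also have "\<dots> = ennreal (G (x - z) (t + s))"
    using t s by (subst nn_integral_eq_integral[OF kernel_semigroup_at_0(1)[OF t s]])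
      (auto simp: kernel_semigroup_at_0(2) kernel_pos less_imp_le)
  finally show ?thesis .
qed

text \<open>Radial monotonicity bounds \<open>G w t\<close> for \<open>\<bar>w\<bar> \<ge> r / 2\<close> by its mean over the ball of radius \<open>r / 2\<close> that
  touches the sphere through \<open>w\<close> from inside, which is contained in \<open>ball w r\<close>.\<close>

lemma kernel_le_local_mass:
  assumes t: "t > 0" and r: "r > 0"
  shows "emeasure lborel (ball (0::'a) (r / 2)) * ennreal (G w t)
      \<le> (\<integral>\<^sup>+z. ennreal (G z t) * indicator (ball w r) z \<partial>lborel)
        + emeasure lborel (ball (0::'a) (r / 2)) * (ennreal (G 0 t) * indicator (ball w r) 0)"
proof (cases "norm w \<ge> r / 2")
  case True
  then have w: "norm w > 0" using r by linarith
  define w' where "w' = (1 - (r / 2) / norm w) *\<^sub>R w"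
  have nw': "norm w' = norm w - r / 2"
    using w True by (simp add: w'_def abs_of_nonneg field_simps)
  have "w - w' = ((r / 2) / norm w) *\<^sub>R w" by (simp add: w'_def algebra_simps)
  then have dw': "dist w w' = r / 2" using w r by (simp add: dist_norm)
  have sub: "ball w' (r / 2) \<subseteq> ball w r"
  proof
    fix z assume "z \<in> ball w' (r / 2)"
    then show "z \<in> ball w r" using dw' dist_triangle[of w z w'] by simp
  qed
  have le: "G w t \<le> G z t" if "z \<in> ball w' (r / 2)" for z
  proof (rule kernel_radially_decreasing[OF t])
    have "norm (z - w') < r / 2" using that by (simp add: dist_norm norm_minus_commute)
    moreover have "norm z \<le> norm w' + norm (z - w')" by norm
    ultimately show "norm z \<le> norm w" using nw' by linarith
  qed
  have "emeasure lborel (ball (0::'a) (r / 2)) * ennreal (G w t)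
      = (\<integral>\<^sup>+z. ennreal (G w t) * indicator (ball w' (r / 2)) z \<partial>lborel)"
    using r by (simp add: nn_integral_cmult_indicator emeasure_ball mult.commute)
  also have "\<dots> \<le> (\<integral>\<^sup>+z. ennreal (G z t) * indicator (ball w r) z \<partial>lborel)"
    using sub le by (intro nn_integral_mono) (auto simp: indicator_def ennreal_leI)
  finally show ?thesis by (simp add: add_increasing2)
next
  case False
  then have "0 \<in> ball w r" using r by (simp add: dist_norm)
  moreover have "G w t \<le> G 0 t" by (rule kernel_radially_decreasing[OF t]) simp
  ultimately show ?thesis
    by (intro add_increasing) (auto intro!: mult_left_mono ennreal_leI)
qed

text \<open>After multiplication by the volume of the half ball, a local mass of \<open>G\<close>
  replaces its pointwise value, and Tonelli's theorem moves the localisation from \<open>G\<close>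
  to \<open>f\<close>, where the hypothesis applies. The unit mass of the kernel then sums the
  pieces, so no decay estimate at infinity enters.\<close>

lemma kernel_smoothing:
  obtains C where "C \<ge> 1"
    "\<And>t (f :: 'a \<Rightarrow> ennreal) A x. \<lbrakk>t > 0; f \<in> borel_measurable borel;
      \<And>z. (\<integral>\<^sup>+y\<in>ball z (t powr (1 / \<theta>)). f y \<partial>lborel) \<le> A * emeasure lborel (ball z (t powr (1 / \<theta>)))\<rbrakk>
      \<Longrightarrow> (\<integral>\<^sup>+y. ennreal (G (x - y) t) * f y \<partial>lborel) \<le> ennreal C * A"
proof -
  define N where "N = DIM('a)"
  obtain C0 where C0: "C0 \<ge> 0" "\<And>x t. t > 0 \<Longrightarrow> G x t \<le> C0 * t powr (- (real DIM('a) / \<theta>))"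
    using kernel_bound by blast
  define \<omega> where "\<omega> = unit_ball_vol (real N)"
  have \<omega>: "\<omega> > 0" by (simp add: \<omega>_def)
  \<comment> \<open>The volume ratio of the balls of radius r and r / 2 gives 2^N. The term near the
    origin, where the touching ball does not fit, gives C0 \<omega> because t^(-N/\<theta>) r^N =
    1.\<close>
  define C where "C = 2 ^ N + C0 * \<omega>"
  show ?thesis
  proof (rule that[of C])
    have "(1::real) \<le> 2 ^ N" by (rule one_le_power) simp
    then show "C \<ge> 1" using C0(1) \<omega> by (simp add: C_def add_increasing2)
    fix t :: real and f :: "'a \<Rightarrow> ennreal" and A x
    assume t: "t > 0" and f[measurable]: "f \<in> borel_measurable borel"
      and A: "\<And>z. (\<integral>\<^sup>+y\<in>ball z (t powr (1 / \<theta>)). f y \<partial>lborel) \<le> A * emeasure lborel (ball z (t powr (1 / \<theta>)))"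
    define r where "r = t powr (1 / \<theta>)"
    have r: "r > 0" using t by (simp add: r_def)
    have rN: "t powr (- (real DIM('a) / \<theta>)) * r ^ N = 1"
      using t \<theta> by (simp add: r_def N_def powr_powr powr_add[symmetric] flip: powr_realpow)
    define v where "v = \<omega> * (r / 2) ^ N"
    have v: "v > 0" using \<omega> r by (simp add: v_def)
    have v_ball: "emeasure lborel (ball (0::'a) (r / 2)) = ennreal v"
      using r by (simp add: emeasure_ball v_def \<omega>_def N_def)
    have V_ball: "emeasure lborel (ball z r) = ennreal (\<omega> * r ^ N)" for z :: 'a
      using r by (simp add: emeasure_ball \<omega>_def N_def)
    have A': "(\<integral>\<^sup>+y. f y * indicator (ball z r) y \<partial>lborel) \<le> A * ennreal (\<omega> * r ^ N)" for z
      using A[of z] by (simp add: r_def[symmetric] V_ball)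
    have [measurable]: "(\<lambda>x. G x t) \<in> borel_measurable borel" using t by (rule kernel_borel_measurable_space)
    have [measurable]: "(\<lambda>y. G (x - y) t) \<in> borel_measurable borel"
      by (rule measurable_compose[of "\<lambda>y. x - y" borel borel "\<lambda>x. G x t"]) measurable
    have [measurable]: "indicator (ball z r) \<in> borel_measurable (borel :: 'a measure)" for z
      by (intro borel_measurable_indicator) simp
    have [measurable]: "Measurable.pred (borel \<Otimes>\<^sub>M borel) (\<lambda>p::'a \<times> 'a. fst p \<in> ball (x - snd p) r)"
      "Measurable.pred (borel \<Otimes>\<^sub>M borel) (\<lambda>p::'a \<times> 'a. snd p \<in> ball (x - fst p) r)"
      unfolding mem_ball by measurable
    \<comment> \<open>This symmetry turns a ball in z around x - y, which localises
      \<open>G\<close>, into a ball in y around x - z, which localises \<open>f\<close>.\<close>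
    have ind: "indicator (ball (x - y) r) z = (indicator (ball (x - z) r) y :: ennreal)" for y z
      by (auto simp: indicator_def dist_norm algebra_simps norm_minus_commute)
    have sym: "indicator (ball (x - y) r) 0 = (indicator (ball x r) y :: ennreal)" for y
      by (auto simp: indicator_def dist_norm)
    have "ennreal v * (\<integral>\<^sup>+y. ennreal (G (x - y) t) * f y \<partial>lborel)
        = (\<integral>\<^sup>+y. (ennreal v * ennreal (G (x - y) t)) * f y \<partial>lborel)"
      by (subst nn_integral_cmult[symmetric]) (auto simp: mult.assoc)
    also have "\<dots> \<le> (\<integral>\<^sup>+y. ((\<integral>\<^sup>+z. ennreal (G z t) * indicator (ball (x - y) r) z \<partial>lborel)
        + ennreal v * (ennreal (G 0 t) * indicator (ball (x - y) r) 0)) * f y \<partial>lborel)"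
      by (intro nn_integral_mono mult_right_mono)
         (use kernel_le_local_mass[OF t r] in \<open>auto simp: v_ball\<close>)
    also have "\<dots> = (\<integral>\<^sup>+y. (\<integral>\<^sup>+z. ennreal (G z t) * (f y * indicator (ball (x - z) r) y) \<partial>lborel)
        + ennreal v * ennreal (G 0 t) * (f y * indicator (ball x r) y) \<partial>lborel)"
    proof (intro nn_integral_cong)
      fix y
      have "(\<integral>\<^sup>+z. ennreal (G z t) * indicator (ball (x - y) r) z \<partial>lborel) * f y
          = (\<integral>\<^sup>+z. ennreal (G z t) * indicator (ball (x - y) r) z * f y \<partial>lborel)"
        by (rule nn_integral_multc[symmetric]) measurable
      also have "\<dots> = (\<integral>\<^sup>+z. ennreal (G z t) * (f y * indicator (ball (x - z) r) y) \<partial>lborel)"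
        by (intro nn_integral_cong, subst ind) (simp only: mult_ac)
      finally show "((\<integral>\<^sup>+z. ennreal (G z t) * indicator (ball (x - y) r) z \<partial>lborel)
          + ennreal v * (ennreal (G 0 t) * indicator (ball (x - y) r) 0)) * f y
        = (\<integral>\<^sup>+z. ennreal (G z t) * (f y * indicator (ball (x - z) r) y) \<partial>lborel)
          + ennreal v * ennreal (G 0 t) * (f y * indicator (ball x r) y)"
        unfolding sym by (simp only: distrib_right distrib_left mult_ac)
    qed
    also have "\<dots> = (\<integral>\<^sup>+y. (\<integral>\<^sup>+z. ennreal (G z t) * (f y * indicator (ball (x - z) r) y) \<partial>lborel) \<partial>lborel)
        + (\<integral>\<^sup>+y. ennreal v * ennreal (G 0 t) * (f y * indicator (ball x r) y) \<partial>lborel)"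
      by (rule nn_integral_add; measurable)
    also have "(\<integral>\<^sup>+y. (\<integral>\<^sup>+z. ennreal (G z t) * (f y * indicator (ball (x - z) r) y) \<partial>lborel) \<partial>lborel)
        = (\<integral>\<^sup>+z. (\<integral>\<^sup>+y. ennreal (G z t) * (f y * indicator (ball (x - z) r) y) \<partial>lborel) \<partial>lborel)"
      by (rule lborel_pair.Fubini') measurable
    also have "\<dots> \<le> (\<integral>\<^sup>+z. ennreal (G z t) * (A * ennreal (\<omega> * r ^ N)) \<partial>lborel)"
      by (intro nn_integral_mono) (simp add: nn_integral_cmult A' mult_left_mono)
    also have "\<dots> = A * ennreal (\<omega> * r ^ N)"
      by (simp add: nn_integral_multc kernel_mass[OF t])
    also have "(\<integral>\<^sup>+y. ennreal v * ennreal (G 0 t) * (f y * indicator (ball x r) y) \<partial>lborel)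
        \<le> ennreal v * ennreal (C0 * t powr (- (real DIM('a) / \<theta>))) * (A * ennreal (\<omega> * r ^ N))"
      by (subst nn_integral_cmult) (auto intro!: mult_mono ennreal_leI C0(2)[OF t] A')
    also have "A * ennreal (\<omega> * r ^ N) + ennreal v * ennreal (C0 * t powr (- (real DIM('a) / \<theta>))) * (A * ennreal (\<omega> * r ^ N))
        = (ennreal (\<omega> * r ^ N) + ennreal v * ennreal (C0 * t powr (- (real DIM('a) / \<theta>))) * ennreal (\<omega> * r ^ N)) * A"
      by (simp only: distrib_right distrib_left mult_ac)
    also have "ennreal (\<omega> * r ^ N) + ennreal v * ennreal (C0 * t powr (- (real DIM('a) / \<theta>))) * ennreal (\<omega> * r ^ N) = ennreal (v * C)"
    proof -
      have "\<omega> * r ^ N = v * 2 ^ N" by (simp add: v_def power_divide)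
      moreover have "v * (C0 * t powr (- (real DIM('a) / \<theta>))) * (\<omega> * r ^ N) = v * (C0 * \<omega>)"
        using rN by (simp add: mult_ac)
      ultimately show ?thesis
        using C0 \<omega> v r by (simp add: C_def ennreal_mult[symmetric] ennreal_plus[symmetric] distrib_left del: ennreal_plus)
    qed
    finally have "ennreal v * (\<integral>\<^sup>+y. ennreal (G (x - y) t) * f y \<partial>lborel) \<le> ennreal v * (ennreal C * A)"
      using v by (auto simp: ennreal_mult' add_mono mult.assoc)
    then show "(\<integral>\<^sup>+y. ennreal (G (x - y) t) * f y \<partial>lborel) \<le> ennreal C * A"
      using v by (subst (asm) ennreal_mult_le_mult_iff) auto
  qed
qed

end

section \<open>The functions \<open>\<Psi>\<close> and \<open>\<rho>\<close>\<close>

lemma ln_exp1_plus_ge_1: "s \<ge> 0 \<Longrightarrow> 1 \<le> ln (exp 1 + s)" for s :: real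
  by (subst ln_ge_iff) (auto simp: add_pos_nonneg)

lemma ln_exp1_plus_mono: "0 \<le> s \<Longrightarrow> s \<le> t \<Longrightarrow> ln (exp 1 + s) \<le> ln (exp 1 + t)" for s t :: real
  by (intro ln_mono) (auto simp: add_pos_nonneg)

lemma Psi_0[simp]: "Psi \<beta> 0 = 0"
  by (simp add: Psi_def)

text \<open>The real-valued core of \<open>Psi_inv\<close>, free of the case distinction at
  infinity.\<close>

definition Psi_inverse :: "real \<Rightarrow> real \<Rightarrow> real" where
  "Psi_inverse \<beta> = the_inv_into {0..} (Psi \<beta>)"

context
  fixes \<beta> :: real
  assumes \<beta>: "\<beta> > 0"
begin

lemma ln_powr_mono: "0 \<le> s \<Longrightarrow> s \<le> t \<Longrightarrow> ln (exp 1 + s) powr \<beta> \<le> ln (exp 1 + t) powr \<beta>"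
  using \<beta> ln_exp1_plus_ge_1[of s] by (intro powr_mono2 ln_exp1_plus_mono) auto

lemma ln_powr_ge_1: "0 \<le> s \<Longrightarrow> 1 \<le> ln (exp 1 + s) powr \<beta>"
  using \<beta> by (intro ge_one_powr_ge_zero ln_exp1_plus_ge_1) auto

lemma Psi_strict_mono:
  assumes "0 \<le> s" "s < t"
  shows "Psi \<beta> s < Psi \<beta> t"
proof -
  have "s * ln (exp 1 + s) powr \<beta> \<le> s * ln (exp 1 + t) powr \<beta>"
    using assms by (intro mult_left_mono ln_powr_mono) auto
  also have "\<dots> < t * ln (exp 1 + t) powr \<beta>"
    using assms ln_powr_ge_1[of t] by (intro mult_strict_right_mono) auto
  finally show ?thesis by (simp add: Psi_def)
qed

lemma Psi_mono: "0 \<le> s \<Longrightarrow> s \<le> t \<Longrightarrow> Psi \<beta> s \<le> Psi \<beta> t"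
  using Psi_strict_mono[of s t] by (cases "s = t") auto

lemma Psi_ge_self: "0 \<le> s \<Longrightarrow> s \<le> Psi \<beta> s"
  using ln_powr_ge_1[of s] mult_left_mono[of 1 "ln (exp 1 + s) powr \<beta>" s] by (simp add: Psi_def)

lemma Psi_nonneg: "0 \<le> s \<Longrightarrow> 0 \<le> Psi \<beta> s"
  by (simp add: Psi_def)

lemma Psi_continuous_on: "continuous_on {0..} (Psi \<beta>)"
proof -
  have "exp 1 + s > 1" if "s \<ge> 0" for s :: real
  proof -
    have "exp (1::real) > 1" by simp
    then show ?thesis using that by linarith
  qed
  then show ?thesis unfolding Psi_def[abs_def] by (intro continuous_intros) force+
qed

lemma Psi_measurable: "Psi \<beta> \<in> borel_measurable borel"
  unfolding Psi_def[abs_def] by measurable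

lemma Psi_bij: "bij_betw (Psi \<beta>) {0..} {0..}"
  unfolding bij_betw_def
proof (intro conjI equalityI subsetI)
  show "inj_on (Psi \<beta>) {0..}"
    by (intro linorder_inj_onI') (auto dest: Psi_strict_mono)
  fix a :: real assume "a \<in> {0..}"
  then have a: "a \<ge> 0" by simp
  obtain s where "0 \<le> s" "s \<le> a" "Psi \<beta> s = a"
    using IVT'[of "Psi \<beta>" 0 a a] a Psi_ge_self[OF a] continuous_on_subset[OF Psi_continuous_on]
    by force
  then show "a \<in> Psi \<beta> ` {0..}" by force
qed (auto simp: Psi_nonneg)

lemma Psi_inverse_nonneg: "a \<ge> 0 \<Longrightarrow> Psi_inverse \<beta> a \<ge> 0"
  and Psi_Psi_inverse: "a \<ge> 0 \<Longrightarrow> Psi \<beta> (Psi_inverse \<beta> a) = a"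
  using Psi_bij the_inv_into_into[of "Psi \<beta>" "{0..}" a "{0..}"] f_the_inv_into_f[of "Psi \<beta>" "{0..}" a]
  by (auto simp: Psi_inverse_def bij_betw_def)

lemma Psi_inverse_le_iff:
  assumes "a \<ge> 0" "b \<ge> 0"
  shows "Psi_inverse \<beta> a \<le> b \<longleftrightarrow> a \<le> Psi \<beta> b"
  using Psi_mono[OF Psi_inverse_nonneg[OF assms(1)], of b] Psi_strict_mono[OF assms(2), of "Psi_inverse \<beta> a"]
    Psi_Psi_inverse[OF assms(1)] by (cases "Psi_inverse \<beta> a \<le> b") auto

text \<open>Lets the smoothing constant pass inside \<open>Psi\<close>, where the choice of \<gamma>
  compensates it.\<close>

lemma mult_Psi_le:
  assumes "C \<ge> 1" "a \<ge> 0"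
  shows "C * Psi \<beta> a \<le> Psi \<beta> (C * a)"
proof -
  have "ln (exp 1 + a) powr \<beta> \<le> ln (exp 1 + C * a) powr \<beta>"
    using assms mult_right_mono[of 1 C a] by (intro ln_powr_mono) auto
  then show ?thesis using assms by (simp add: Psi_def mult_left_mono mult.assoc)
qed

text \<open>This splitting replaces Jensen's inequality: averaging it bounds the average of \<open>s\<close> by twice
  the \<open>Psi\<close>-mean \<open>w\<close>.\<close>

lemma le_plus_Psi:
  assumes "s \<ge> 0" "w \<ge> 0"
  shows "s \<le> w + Psi \<beta> s / ln (exp 1 + w) powr \<beta>"
proof (cases "s \<le> w")
  case True
  then show ?thesis using Psi_nonneg[OF assms(1)] by (simp add: add_increasing2)
next
  case False
  then have "ln (exp 1 + w) powr \<beta> \<le> ln (exp 1 + s) powr \<beta>" using assms by (intro ln_powr_mono) auto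
  then have "s * ln (exp 1 + w) powr \<beta> \<le> Psi \<beta> s" using assms by (simp add: Psi_def mult_left_mono)
  then have "s \<le> Psi \<beta> s / ln (exp 1 + w) powr \<beta>"
    using ln_powr_ge_1[OF assms(2)] by (subst pos_le_divide_eq) auto
  then show ?thesis using assms by linarith
qed

end

section \<open>Logarithms and the critical weight\<close>

text \<open>With L the logarithm on the right, e + R \<le> (e + \<epsilon> R) / \<epsilon> gives the
  bound L - ln \<epsilon>, and L \<ge> 1 allows the nonnegative summand -ln \<epsilon> to be
  multiplied by L.\<close>

lemma ln_exp1_plus_scale:
  fixes R \<epsilon> :: real
  assumes "R \<ge> 0" "0 < \<epsilon>" "\<epsilon> \<le> 1"
  shows "ln (exp 1 + R) \<le> ln (exp 1 + \<epsilon> * R) * (1 - ln \<epsilon>)"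
proof -
  have pos: "exp 1 + \<epsilon> * R > 0" using assms by (simp add: add_pos_nonneg)
  have "\<epsilon> * exp 1 \<le> exp (1::real)" using assms by (simp add: mult_left_le_one_le)
  then have "exp 1 + R \<le> (exp 1 + \<epsilon> * R) / \<epsilon>" using assms by (simp add: field_simps)
  then have "ln (exp 1 + R) \<le> ln ((exp 1 + \<epsilon> * R) / \<epsilon>)" using assms by (intro ln_mono) (auto simp: add_pos_nonneg)
  also have "\<dots> = ln (exp 1 + \<epsilon> * R) - ln \<epsilon>" using assms pos by (subst ln_div) auto
  also have "\<dots> \<le> ln (exp 1 + \<epsilon> * R) * (1 - ln \<epsilon>)"
    using ln_exp1_plus_ge_1[of "\<epsilon> * R"] assms mult_right_mono[of 1 "ln (exp 1 + \<epsilon> * R)" "- ln \<epsilon>"]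
    by (simp add: algebra_simps)
  finally show ?thesis .
qed

lemma ln_powr_le_powr:
  assumes "a > 0" "b > (0::real)"
  obtains K where "K \<ge> 1" "\<And>z. z \<ge> 1 \<Longrightarrow> (1 + ln z) powr a \<le> K * z powr b"
proof
  \<comment> \<open>With this exponent c ln z = ln (z^c) \<le> z^c; adding c \<le> c z^c gives 1 +
    ln z \<le> (1 + 1 / c) z^c, and raising to the power a produces z^b.\<close>
  define c where "c = b / a"
  have c: "c > 0" using assms by (simp add: c_def)
  show "(1 + 1 / c) powr a \<ge> 1" using c assms by (intro ge_one_powr_ge_zero) auto
  fix z :: real assume z: "z \<ge> 1"
  have zc: "z powr c \<ge> 1" using z c by (intro ge_one_powr_ge_zero) auto
  have "c * ln z = ln (z powr c)" using z by (simp add: ln_powr)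
  also have "\<dots> \<le> z powr c" using z by (intro order_trans[OF ln_le_minus_one]) auto
  finally have "c * (1 + ln z) \<le> c * z powr c + z powr c"
    using mult_left_mono[OF zc less_imp_le[OF c]] unfolding distrib_left by linarith
  then have "1 + ln z \<le> (1 + 1 / c) * z powr c" using c by (simp add: field_simps)
  then have "(1 + ln z) powr a \<le> ((1 + 1 / c) * z powr c) powr a"
    using z assms by (intro powr_mono2) auto
  also have "\<dots> = (1 + 1 / c) powr a * z powr b"
    using c z assms by (simp add: powr_mult powr_powr c_def)
  finally show "(1 + ln z) powr a \<le> (1 + 1 / c) powr a * z powr b" .
qed

text \<open>The mean of the two lower bounds 1 and ln z.\<close>

lemma ln_exp1_plus_lower: "z > 0 \<Longrightarrow> (1 + ln z) / 2 \<le> ln (exp 1 + z)" for z :: real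
  using ln_exp1_plus_ge_1[of z] ln_mono[of z "exp 1 + z"] by simp

text \<open>The argument is at most (e + 1) z, and e + 1 \<le> e^2 accounts for the constant
  2.\<close>

lemma ln_exp1_plus_upper:
  fixes z :: real
  assumes "z \<ge> 1"
  shows "ln (exp 1 + z) \<le> 2 + ln z"
proof -
  have "(2::real) \<le> exp 1" using exp_ge_add_one_self[of 1] by simp
  then have "2 * exp 1 \<le> exp 1 * exp (1::real)" by (intro mult_right_mono) auto
  then have e2: "exp 1 + 1 \<le> exp (2::real)" using \<open>2 \<le> exp 1\<close> by (simp add: exp_add[symmetric])
  have "exp 1 + z \<le> (exp 1 + 1) * z" using assms mult_left_mono[of 1 z "exp 1"] by (simp add: algebra_simps)
  also have "\<dots> \<le> exp 2 * z" using assms e2 by (intro mult_right_mono) auto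
  finally have "ln (exp 1 + z) \<le> ln (exp 2 * z)" using assms by (intro ln_mono) (auto simp: add_pos_nonneg)
  also have "\<dots> = 2 + ln z" using assms by (subst ln_mult) auto
  finally show ?thesis .
qed

text \<open>Up to constants \<open>log_weight \<theta> \<tau>\<close> is \<open>ln (exp 1 + \<tau> powr (- 1 / \<theta>))\<close> for \<open>0 < \<tau> < 1\<close>, but its powers have
  elementary primitives with respect to \<open>d\<tau> / \<tau>\<close>.\<close>

definition log_weight :: "real \<Rightarrow> real \<Rightarrow> real" where
  "log_weight \<theta> \<tau> = 1 - ln \<tau> / \<theta>"

lemma log_weight_ge_1: "\<theta> > 0 \<Longrightarrow> 0 < \<tau> \<Longrightarrow> \<tau> \<le> 1 \<Longrightarrow> 1 \<le> log_weight \<theta> \<tau>"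
  by (simp add: log_weight_def divide_nonpos_nonneg)

text \<open>In terms of z = \<tau>^(-1/\<theta>) the weight is 1 + ln z, and \<rho> is z^N divided
  by a power of ln(e + z). That power is at most K z^(N/2), so \<rho> lies between z^(N/2) / K and
  z^N, and its logarithm is comparable to the weight.\<close>

lemma rho_bounds:
  fixes \<theta> :: real and N :: nat
  assumes \<theta>: "\<theta> > 0" and N: "N \<ge> 1"
  obtains k where "k > 0"
    "\<And>\<tau>. 0 < \<tau> \<Longrightarrow> \<tau> < 1 \<Longrightarrow> rho N \<theta> (\<tau> powr (1 / \<theta>)) > 0"
    "\<And>\<tau>. 0 < \<tau> \<Longrightarrow> \<tau> < 1 \<Longrightarrow> rho N \<theta> (\<tau> powr (1 / \<theta>)) powr (\<theta> / N) \<le> 2 / (\<tau> * log_weight \<theta> \<tau>)"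
    "\<And>\<tau>. 0 < \<tau> \<Longrightarrow> \<tau> < 1 \<Longrightarrow> k * log_weight \<theta> \<tau> \<le> ln (exp 1 + rho N \<theta> (\<tau> powr (1 / \<theta>)))"
    "\<And>\<tau>. 0 < \<tau> \<Longrightarrow> \<tau> < 1 \<Longrightarrow> ln (exp 1 + rho N \<theta> (\<tau> powr (1 / \<theta>))) \<le> 2 * N * log_weight \<theta> \<tau>"
proof -
  obtain K0 where K0: "K0 \<ge> 1" "\<And>z. z \<ge> 1 \<Longrightarrow> (1 + ln z) powr (N / \<theta>) \<le> K0 * z powr (N / 2)"
    using ln_powr_le_powr[of "N / \<theta>" "N / 2"] \<theta> N by auto
  define K where "K = 2 powr (N / \<theta>) * K0"
  have K: "K \<ge> 1" using K0(1) \<theta> N mult_mono[of 1 "2 powr (N / \<theta>)" 1 K0] by (simp add: K_def ge_one_powr_ge_zero)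
  \<comment> \<open>One factor 1/2 comes from \<open>ln_exp1_plus_lower\<close>, another from the
    exponent N / 2 \<ge> 1 / 2, and 1 + ln K from removing the factor 1 / K by
    \<open>ln_exp1_plus_scale\<close>.\<close>
  define k where "k = 1 / (4 * (1 + ln K))"
  have k: "k > 0" using K by (simp add: k_def add_pos_nonneg)
  have *: "rho N \<theta> (\<tau> powr (1 / \<theta>)) > 0 \<and>
      rho N \<theta> (\<tau> powr (1 / \<theta>)) powr (\<theta> / N) \<le> 2 / (\<tau> * log_weight \<theta> \<tau>) \<and>
      k * log_weight \<theta> \<tau> \<le> ln (exp 1 + rho N \<theta> (\<tau> powr (1 / \<theta>))) \<and>
      ln (exp 1 + rho N \<theta> (\<tau> powr (1 / \<theta>))) \<le> 2 * N * log_weight \<theta> \<tau>"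
    if \<tau>: "0 < \<tau>" "\<tau> < 1" for \<tau>
  proof -
    define z where "z = \<tau> powr (- (1 / \<theta>))"
    have lnz: "ln z = - ln \<tau> / \<theta>" using \<tau> by (simp add: z_def ln_powr)
    have lw: "log_weight \<theta> \<tau> = 1 + ln z" by (simp add: lnz log_weight_def)
    have z0: "z > 0" using \<tau> by (simp add: z_def)
    have lnz0: "ln z \<ge> 0" using \<tau> \<theta> by (simp add: lnz divide_nonpos_pos)
    then have z1: "z \<ge> 1" using z0 by simp
    define L where "L = ln (exp 1 + z)"
    have L1: "L \<ge> 1" using z0 ln_exp1_plus_ge_1[of z] by (simp add: L_def)
    define R where "R = rho N \<theta> (\<tau> powr (1 / \<theta>))"
    have "1 / \<tau> powr (1 / \<theta>) = z" by (simp add: z_def powr_minus_divide)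
    moreover have "(\<tau> powr (1 / \<theta>)) powr (- real N) = z powr N" by (simp add: z_def powr_powr)
    ultimately have R: "R = z powr N * L powr (- (N / \<theta>))"
      by (simp add: R_def rho_def L_def)
    have R0: "R > 0" using z0 L1 by (simp add: R)
    \<comment> \<open>The exponent \<theta> / N = p - 1 turns the power -N / \<theta> of the
      logarithm into exactly -1: the borderline of integrability.\<close>
    have "R powr (\<theta> / N) = z powr \<theta> * L powr (- 1)"
      using \<theta> N z0 L1 by (simp add: R powr_mult powr_powr)
    also have "\<dots> = 1 / (\<tau> * L)"
    proof -
      have "z powr \<theta> = 1 / \<tau>" unfolding z_def powr_powr using \<theta> \<tau> by (simp add: powr_minus_divide)
      then show ?thesis using L1 by (simp add: powr_minus_divide)
    qed
    also have "\<dots> \<le> 2 / (\<tau> * log_weight \<theta> \<tau>)"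
    proof -
      have "log_weight \<theta> \<tau> \<le> 2 * L" using ln_exp1_plus_lower[OF z0] by (simp add: lw L_def)
      then show ?thesis using \<tau> L1 lnz0 by (simp add: lw divide_simps)
    qed
    finally have 1: "R powr (\<theta> / N) \<le> 2 / (\<tau> * log_weight \<theta> \<tau>)" .
    have "L \<le> 2 * (1 + ln z)" using ln_exp1_plus_upper[OF z1] lnz0 by (simp add: L_def)
    then have "L powr (N / \<theta>) \<le> (2 * (1 + ln z)) powr (N / \<theta>)"
      using L1 \<theta> by (intro powr_mono2) auto
    also have "\<dots> = 2 powr (N / \<theta>) * (1 + ln z) powr (N / \<theta>)" using lnz0 by (subst powr_mult) auto
    also have "\<dots> \<le> K * z powr (N / 2)" using K0(2)[OF z1] by (simp add: K_def mult.assoc)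
    finally have LK: "L powr (N / \<theta>) \<le> K * z powr (N / 2)" .
    have "1 / K * z powr (N / 2) = z powr N / (K * z powr (N / 2))"
    proof -
      have "z powr N = z powr (N / 2) * z powr (N / 2)" by (simp add: powr_add[symmetric])
      then show ?thesis using z0 by simp
    qed
    also have "\<dots> \<le> z powr N / L powr (N / \<theta>)"
      using LK L1 K z0 by (intro divide_left_mono) auto
    also have "\<dots> = R" by (simp add: R powr_minus divide_inverse)
    finally have RK: "1 / K * z powr (N / 2) \<le> R" .
    have "(1 + ln z) / 4 \<le> (1 + ln (z powr (N / 2))) / 2"
    proof -
      have "ln z \<le> N * ln z" using N lnz0 by (simp add: mult_le_cancel_right1)
      then show ?thesis using z0 by (simp add: ln_powr)
    qed
    also have "\<dots> \<le> ln (exp 1 + z powr (N / 2))" using z0 by (intro ln_exp1_plus_lower) auto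
    also have "\<dots> \<le> ln (exp 1 + 1 / K * z powr (N / 2)) * (1 - ln (1 / K))"
      by (rule ln_exp1_plus_scale) (use K in auto)
    also have "\<dots> \<le> ln (exp 1 + R) * (1 - ln (1 / K))"
      using K RK by (intro mult_right_mono ln_exp1_plus_mono) (auto simp: ln_div)
    also have "1 - ln (1 / K) = 1 + ln K" using K by (simp add: ln_div)
    finally have 2: "k * log_weight \<theta> \<tau> \<le> ln (exp 1 + R)"
      using K by (simp add: k_def lw field_simps add_pos_nonneg)
    have "L powr (- (N / \<theta>)) \<le> 1" using powr_mono[of "- (N / \<theta>)" 0 L] L1 \<theta> by simp
    then have "R \<le> z powr N" unfolding R by (intro mult_left_le) auto
    then have "ln (exp 1 + R) \<le> ln (exp 1 + z powr N)" using R0 by (intro ln_exp1_plus_mono) auto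
    also have "\<dots> \<le> 2 + ln (z powr N)" using z1 by (intro ln_exp1_plus_upper ge_one_powr_ge_zero) auto
    also have "\<dots> \<le> 2 * N * (1 + ln z)"
    proof -
      have "N * ln z \<ge> 0" using lnz0 by simp
      then show ?thesis using z0 N by (simp add: ln_powr distrib_left)
    qed
    finally have 3: "ln (exp 1 + R) \<le> 2 * N * log_weight \<theta> \<tau>" by (simp add: lw)
    show ?thesis using R0 1 2 3 unfolding R_def by blast
  qed
  show ?thesis by (rule that[OF k]) (use * in blast)+
qed

text \<open>The first estimate controls the quotient of W^p by \<open>Psi \<beta> W\<close>, with a
  power of c that can be made small. The second compares \<open>Psi \<beta> W\<close> with W once
  the time integral has produced the weight to the power -\<beta>.\<close>

lemma supersolution_weight:
  fixes \<theta> \<beta> :: real and N :: nat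
  assumes \<theta>: "\<theta> > 0" and N: "N \<ge> 1" and \<beta>: "\<beta> > 0"
  obtains K where "K > 0"
    "\<And>c \<tau> W. 0 < c \<Longrightarrow> c \<le> 1 \<Longrightarrow> 0 < \<tau> \<Longrightarrow> \<tau> < 1 \<Longrightarrow> 0 \<le> W \<Longrightarrow> W \<le> c * rho N \<theta> (\<tau> powr (1 / \<theta>)) \<Longrightarrow>
       W powr (\<theta> / N) * ln (exp 1 + W) powr (- \<beta>)
         \<le> K * c powr (\<theta> / N / 2) * (1 / \<tau> * log_weight \<theta> \<tau> powr (- 1 - \<beta>))"
    "\<And>c \<tau> W. 0 < c \<Longrightarrow> c \<le> 1 \<Longrightarrow> 0 < \<tau> \<Longrightarrow> \<tau> < 1 \<Longrightarrow> 0 \<le> W \<Longrightarrow> W \<le> c * rho N \<theta> (\<tau> powr (1 / \<theta>)) \<Longrightarrow>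
       ln (exp 1 + W) powr \<beta> \<le> K * log_weight \<theta> \<tau> powr \<beta>"
proof -
  define \<kappa> where "\<kappa> = \<theta> / N"
  have \<kappa>: "\<kappa> > 0" using \<theta> N by (simp add: \<kappa>_def)
  obtain k where k: "k > 0"
    "\<And>\<tau>. 0 < \<tau> \<Longrightarrow> \<tau> < 1 \<Longrightarrow> rho N \<theta> (\<tau> powr (1 / \<theta>)) > 0"
    "\<And>\<tau>. 0 < \<tau> \<Longrightarrow> \<tau> < 1 \<Longrightarrow> rho N \<theta> (\<tau> powr (1 / \<theta>)) powr \<kappa> \<le> 2 / (\<tau> * log_weight \<theta> \<tau>)"
    "\<And>\<tau>. 0 < \<tau> \<Longrightarrow> \<tau> < 1 \<Longrightarrow> k * log_weight \<theta> \<tau> \<le> ln (exp 1 + rho N \<theta> (\<tau> powr (1 / \<theta>)))"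
    "\<And>\<tau>. 0 < \<tau> \<Longrightarrow> \<tau> < 1 \<Longrightarrow> ln (exp 1 + rho N \<theta> (\<tau> powr (1 / \<theta>))) \<le> 2 * N * log_weight \<theta> \<tau>"
    using rho_bounds[OF \<theta> N] unfolding \<kappa>_def by blast
  obtain K1 where K1: "K1 \<ge> 1" "\<And>z. z \<ge> 1 \<Longrightarrow> (1 + ln z) powr \<beta> \<le> K1 * z powr (\<kappa> / 2)"
    using ln_powr_le_powr[OF \<beta>, of "\<kappa> / 2"] \<kappa> by auto
  define K where "K = max (2 * k powr (- \<beta>) * K1) ((2 * N) powr \<beta>)"
  have K: "K > 0" using N by (simp add: K_def less_max_iff_disj)
  show ?thesis
  proof (rule that[OF K])
    fix c \<tau> W :: real
    assume c: "0 < c" "c \<le> 1" and \<tau>: "0 < \<tau>" "\<tau> < 1" and W: "0 \<le> W" "W \<le> c * rho N \<theta> (\<tau> powr (1 / \<theta>))"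
    define R where "R = rho N \<theta> (\<tau> powr (1 / \<theta>))"
    have R: "R > 0" using k(2)[OF \<tau>] by (simp add: R_def)
    define \<Lambda> where "\<Lambda> = log_weight \<theta> \<tau>"
    have \<Lambda>: "\<Lambda> \<ge> 1" using log_weight_ge_1[OF \<theta>] \<tau> by (simp add: \<Lambda>_def)
    have "c * R \<le> 1 * R" using c R by (intro mult_right_mono) auto
    then have WR: "W \<le> R" using W(2) unfolding R_def[symmetric] by linarith
    have "ln (exp 1 + W) \<le> 2 * N * \<Lambda>"
      using ln_exp1_plus_mono[OF W(1) WR] k(5)[OF \<tau>] by (simp add: R_def \<Lambda>_def)
    then have "ln (exp 1 + W) powr \<beta> \<le> (2 * N * \<Lambda>) powr \<beta>"
      using \<beta> ln_exp1_plus_ge_1[OF W(1)] by (intro powr_mono2) auto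
    also have "\<dots> = (2 * N) powr \<beta> * \<Lambda> powr \<beta>" using \<Lambda> by (simp add: powr_mult)
    also have "\<dots> \<le> K * \<Lambda> powr \<beta>" by (intro mult_right_mono) (auto simp: K_def)
    finally show "ln (exp 1 + W) powr \<beta> \<le> K * log_weight \<theta> \<tau> powr \<beta>" by (simp add: \<Lambda>_def)
    show "W powr (\<theta> / N) * ln (exp 1 + W) powr (- \<beta>)
         \<le> K * c powr (\<theta> / N / 2) * (1 / \<tau> * log_weight \<theta> \<tau> powr (- 1 - \<beta>))"
    proof (cases "W = 0")
      case True
      then show ?thesis using K c \<tau> by simp
    next
      case False
      define \<epsilon> where "\<epsilon> = W / R"
      have \<epsilon>: "0 < \<epsilon>" "\<epsilon> \<le> c" using False W R by (auto simp: \<epsilon>_def divide_simps R_def)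
      have \<epsilon>1: "\<epsilon> \<le> 1" using \<epsilon> c by simp
      have W\<epsilon>: "W = \<epsilon> * R" using R by (simp add: \<epsilon>_def)
      \<comment> \<open>The logarithm at W = \<epsilon> R can be smaller than the one at R by up to
        the factor D. The loss D^\<beta> is at most a multiple of \<epsilon>^(-\<kappa>/2), so half
        of the \<epsilon>^\<kappa> contained in W^\<kappa> absorbs it, and the other half is at most
        c^(\<kappa>/2).\<close>
      define D where "D = 1 + ln (1 / \<epsilon>)"
      have D: "D \<ge> 1" using \<epsilon> \<epsilon>1 by (simp add: D_def)
      have "k * \<Lambda> \<le> ln (exp 1 + R)" using k(4)[OF \<tau>] by (simp add: R_def \<Lambda>_def)
      also have "\<dots> \<le> ln (exp 1 + W) * D"
        using ln_exp1_plus_scale[of R \<epsilon>] R \<epsilon> \<epsilon>1 by (simp add: W\<epsilon> D_def ln_div)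
      finally have "(ln (exp 1 + W) * D) powr (- \<beta>) \<le> (k * \<Lambda>) powr (- \<beta>)"
        using k(1) \<Lambda> \<beta> by (intro powr_mono2') auto
      then have "ln (exp 1 + W) powr (- \<beta>) * D powr (- \<beta>) \<le> k powr (- \<beta>) * \<Lambda> powr (- \<beta>)"
        using k(1) \<Lambda> D ln_exp1_plus_ge_1[OF W(1)] by (simp add: powr_mult)
      then have "ln (exp 1 + W) powr (- \<beta>) * D powr (- \<beta>) * D powr \<beta> \<le> k powr (- \<beta>) * \<Lambda> powr (- \<beta>) * D powr \<beta>"
        by (rule mult_right_mono) simp
      moreover have "D powr (- \<beta>) * D powr \<beta> = 1" using D by (simp add: powr_add[symmetric])
      ultimately have "ln (exp 1 + W) powr (- \<beta>) \<le> k powr (- \<beta>) * \<Lambda> powr (- \<beta>) * D powr \<beta>"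
        by (simp only: mult.assoc mult_1_right)
      also have "\<dots> \<le> k powr (- \<beta>) * \<Lambda> powr (- \<beta>) * (K1 * \<epsilon> powr (- (\<kappa> / 2)))"
      proof (intro mult_left_mono)
        have "D powr \<beta> \<le> K1 * (1 / \<epsilon>) powr (\<kappa> / 2)" unfolding D_def using \<epsilon> \<epsilon>1 by (intro K1(2)) auto
        then show "D powr \<beta> \<le> K1 * \<epsilon> powr (- (\<kappa> / 2))"
          using \<epsilon> by (simp add: powr_divide powr_minus_divide)
      qed auto
      finally have 1: "ln (exp 1 + W) powr (- \<beta>) \<le> k powr (- \<beta>) * \<Lambda> powr (- \<beta>) * (K1 * \<epsilon> powr (- (\<kappa> / 2)))" .
      have "W powr \<kappa> = \<epsilon> powr \<kappa> * R powr \<kappa>" using R \<epsilon> by (simp add: W\<epsilon> powr_mult)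
      also have "\<dots> \<le> \<epsilon> powr \<kappa> * (2 / (\<tau> * \<Lambda>))"
        using k(3)[OF \<tau>] unfolding R_def \<Lambda>_def by (intro mult_left_mono) auto
      finally have 2: "W powr \<kappa> \<le> \<epsilon> powr \<kappa> * (2 / (\<tau> * \<Lambda>))" .
      have "W powr \<kappa> * ln (exp 1 + W) powr (- \<beta>)
          \<le> (\<epsilon> powr \<kappa> * (2 / (\<tau> * \<Lambda>))) * (k powr (- \<beta>) * \<Lambda> powr (- \<beta>) * (K1 * \<epsilon> powr (- (\<kappa> / 2))))"
        using 1 2 \<tau> \<Lambda> by (intro mult_mono) auto
      also have "\<dots> = (2 * k powr (- \<beta>) * K1) * \<epsilon> powr (\<kappa> / 2) * (1 / \<tau> * \<Lambda> powr (- 1 - \<beta>))"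
      proof -
        have "\<epsilon> powr (\<kappa> / 2) = \<epsilon> powr \<kappa> * \<epsilon> powr (- (\<kappa> / 2))" by (simp add: powr_add[symmetric])
        moreover have "\<Lambda> powr (- 1 - \<beta>) = \<Lambda> powr (- \<beta>) / \<Lambda>"
          using \<Lambda> powr_add[of \<Lambda> "- 1" "- \<beta>"] by (simp add: powr_minus_divide)
        ultimately show ?thesis by simp
      qed
      also have "\<dots> \<le> K * c powr (\<kappa> / 2) * (1 / \<tau> * \<Lambda> powr (- 1 - \<beta>))"
        using \<epsilon> \<kappa> \<tau> K by (intro mult_right_mono mult_mono powr_mono2) (auto simp: K_def)
      finally show ?thesis by (simp add: \<kappa>_def \<Lambda>_def)
    qed
  qed
qed

lemma log_weight_integral:
  assumes \<theta>: "\<theta> > 0" and \<beta>: "\<beta> > 0" and t: "0 < t" "t < T"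
  shows "(\<integral>\<^sup>+s\<in>{0<..<t}. ennreal (1 / (s / T) * log_weight \<theta> (s / T) powr (- 1 - \<beta>)) \<partial>lborel)
      \<le> ennreal (T * (\<theta> / \<beta>) * log_weight \<theta> (t / T) powr (- \<beta>))"
proof -
  have T: "T > 0" using t by simp
  define f where "f s = 1 / (s / T) * log_weight \<theta> (s / T) powr (- 1 - \<beta>)" for s
  \<comment> \<open>A primitive of \<open>f\<close>: the derivative of the weight is -1 / (\<theta>
    s), which the prefactor matches. As \<beta> > 0, it tends to 0 at the origin, where the weight
    tends to infinity.\<close>
  define F where "F s = T * (\<theta> / \<beta>) * log_weight \<theta> (s / T) powr (- \<beta>)" for s
  have pos: "log_weight \<theta> (s / T) > 0" if "0 < s" "s < T" for s
    using log_weight_ge_1[OF \<theta>, of "s / T"] that by simp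
  have d: "(F has_real_derivative f s) (at s)" if "0 < s" "s < T" for s
    using that pos[OF that] T \<theta> \<beta> unfolding log_weight_def F_def f_def
    by (auto intro!: derivative_eq_intros simp: powr_diff powr_minus divide_simps)
  have c: "isCont f s" if "0 < s" "s < T" for s
    using that pos[OF that] T \<theta> unfolding log_weight_def f_def by (auto intro!: continuous_intros)
  have lim0: "(F \<longlongrightarrow> 0) (at_right 0)"
    using \<theta> \<beta> T unfolding log_weight_def F_def by real_asymp
  have FTC: "set_integrable lborel (einterval (ereal 0) (ereal t)) f \<and> (LBINT s=ereal 0..ereal t. f s) = F t - 0"
  proof (intro conjI)
    have A: "((F \<circ> real_of_ereal) \<longlongrightarrow> 0) (at_right (ereal 0))"
      using lim0 by (simp add: ereal_tendsto_simps1)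
    have "(F \<longlongrightarrow> F t) (at_left t)"
      using DERIV_isCont[OF d[OF t]] by (intro filterlim_at_split[THEN iffD1, THEN conjunct1]) (simp add: isCont_def)
    then have B: "((F \<circ> real_of_ereal) \<longlongrightarrow> F t) (at_left (ereal t))"
      by (simp add: ereal_tendsto_simps1)
    have n: "AE x in lborel. ereal 0 < ereal x \<longrightarrow> ereal x < ereal t \<longrightarrow> 0 \<le> f x"
      using T by (auto simp: f_def)
    have lt: "ereal 0 < ereal t" using t by simp
    note r = interval_integral_FTC_nonneg[OF lt _ _ n A B]
    show "set_integrable lborel (einterval (ereal 0) (ereal t)) f"
      by (rule r(1)) (use t d c in auto)
    show "(LBINT s=ereal 0..ereal t. f s) = F t - 0"
      by (rule r(2)) (use t d c in auto)
  qed
  then have i: "integrable lborel (\<lambda>s. indicator {0<..<t} s * f s)" and v: "(\<integral>s. indicator {0<..<t} s * f s \<partial>lborel) = F t"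
    using t by (auto simp: set_integrable_def interval_lebesgue_integral_def set_lebesgue_integral_def einterval_eq)
  have "(\<integral>\<^sup>+s\<in>{0<..<t}. ennreal (f s) \<partial>lborel) = (\<integral>\<^sup>+s. ennreal (indicator {0<..<t} s * f s) \<partial>lborel)"
    by (intro nn_integral_cong) (auto simp: indicator_def)
  also have "\<dots> = ennreal (F t)"
    unfolding v[symmetric]
    by (rule nn_integral_eq_integral[OF i]) (use T in \<open>auto simp: f_def indicator_def\<close>)
  finally show ?thesis by (simp add: f_def F_def)
qed

section \<open>Supersolutions\<close>

text \<open>The iterates starting from 0 increase and stay below \<open>V\<close>, and monotone
  convergence passes to the limit in the equation. \<open>V\<close> carries no measurability
  hypothesis because it enters only through monotonicity of \<open>nn_integral\<close>;
  \<open>u\<close> is measurable as a limit of measurable iterates.\<close>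

theorem integral_equation_of_supersolution:
  fixes G :: "'a::euclidean_space \<Rightarrow> real \<Rightarrow> real" and a :: "'a \<times> real \<Rightarrow> ennreal" and V :: "'a \<times> real \<Rightarrow> real"
  assumes p: "p > 0"
    and G: "(\<lambda>z. if snd z > 0 then G (fst z) (snd z) else 0) \<in> borel_measurable borel"
    and a: "a \<in> borel_measurable borel"
    and V: "\<And>z. V z \<ge> 0"
    and super: "\<And>x t. 0 < t \<Longrightarrow> t < T \<Longrightarrow>
      a (x, t) + (\<integral>\<^sup>+s\<in>{0<..<t}. (\<integral>\<^sup>+y. ennreal (G (x - y) (t - s) * V (y, s) powr p) \<partial>lborel) \<partial>lborel) \<le> ennreal (V (x, t))"
  obtains u :: "'a \<times> real \<Rightarrow> real" where "u \<in> borel_measurable borel" "\<And>z. u z \<ge> 0"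
    "\<And>x t. 0 < t \<Longrightarrow> t < T \<Longrightarrow> ennreal (u (x, t)) =
      a (x, t) + (\<integral>\<^sup>+s\<in>{0<..<t}. (\<integral>\<^sup>+y. ennreal (G (x - y) (t - s) * u (y, s) powr p) \<partial>lborel) \<partial>lborel)"
proof -
  define k where "k z = (if snd z > 0 then G (fst z) (snd z) else 0)" for z :: "'a \<times> real"
  have k[measurable]: "k \<in> borel_measurable (borel \<Otimes>\<^sub>M borel)"
    using G unfolding borel_prod by (simp add: k_def[abs_def])
  have a'[measurable]: "a \<in> borel_measurable (borel \<Otimes>\<^sub>M borel)" using a unfolding borel_prod .
  \<comment> \<open>\<open>k\<close> vanishes for s \<ge> t and the indicator for s \<le> 0, so both
    integrals run over the whole space and the integrand is jointly measurable in all
    variables.\<close>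
  define I where "I v x t = (\<integral>\<^sup>+s. (\<integral>\<^sup>+y. ennreal (k (x - y, t - s)) * ennreal (v (y, s) powr p) * indicator {0<..} s \<partial>lborel) \<partial>lborel)"
    for v :: "'a \<times> real \<Rightarrow> real" and x t
  have I_eq: "I v x t = (\<integral>\<^sup>+s\<in>{0<..<t}. (\<integral>\<^sup>+y. ennreal (G (x - y) (t - s) * v (y, s) powr p) \<partial>lborel) \<partial>lborel)" for v x t
    unfolding I_def by (intro nn_integral_cong) (auto simp: k_def indicator_def ennreal_mult'' intro!: nn_integral_cong)
  define Op where "Op v z = a z + I v (fst z) (snd z)" for v z
  have Op_measurable: "Op v \<in> borel_measurable (borel \<Otimes>\<^sub>M borel)"
    if [measurable]: "v \<in> borel_measurable (borel \<Otimes>\<^sub>M borel)" for v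
    unfolding Op_def[abs_def] I_def by measurable
  \<comment> \<open>The iterates live in \<open>ennreal\<close> because they may be infinite outside
    0 < t < T. There \<open>enn2real\<close> returns 0 for infinity, which is harmless as only times
    between 0 and t enter \<open>I\<close>.\<close>
  define U where "U n = ((\<lambda>w. Op (\<lambda>z. enn2real (w z))) ^^ n) (\<lambda>_. 0)" for n
  have U_Suc: "U (Suc n) = Op (\<lambda>z. enn2real (U n z))" for n by (simp add: U_def)
  have U_I: "U (Suc n) (x, t) = a (x, t) + I (\<lambda>z. enn2real (U n z)) x t" for n x t
    by (simp add: U_Suc Op_def)
  have U_0: "U 0 = (\<lambda>_. 0)" by (simp add: U_def)
  have Um[measurable]: "U n \<in> borel_measurable (borel \<Otimes>\<^sub>M borel)" for n
  proof (induction n)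
    case (Suc n)
    then have [measurable]: "U n \<in> borel_measurable (borel \<Otimes>\<^sub>M borel)" .
    show ?case unfolding U_Suc by (rule Op_measurable) measurable
  qed (simp add: U_0)
  have I_mono: "I v x t \<le> I w x t" if vw: "\<And>y s. 0 < s \<Longrightarrow> s < t \<Longrightarrow> 0 \<le> v (y, s) \<and> v (y, s) \<le> w (y, s)" for v w x t
    unfolding I_eq
  proof (intro nn_integral_mono)
    fix s
    show "(\<integral>\<^sup>+y. ennreal (G (x - y) (t - s) * v (y, s) powr p) \<partial>lborel) * indicator {0<..<t} s
        \<le> (\<integral>\<^sup>+y. ennreal (G (x - y) (t - s) * w (y, s) powr p) \<partial>lborel) * indicator {0<..<t} s"
    proof (cases "0 < s \<and> s < t")
      case True
      have "v (y, s) powr p \<le> w (y, s) powr p" for y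
        using vw[of s y] True p by (intro powr_mono2) auto
      then show ?thesis using True
        by (auto simp: ennreal_mult'' intro!: nn_integral_mono mult_left_mono ennreal_leI)
    qed simp
  qed
  have UV: "U n (x, t) \<le> ennreal (V (x, t))" if "0 < t" "t < T" for n x t
    using that
  proof (induction n arbitrary: x t)
    case (Suc n)
    have "U (Suc n) (x, t) \<le> a (x, t) + I V x t"
      unfolding U_I
    proof (intro add_left_mono I_mono)
      fix y s assume "0 < s" "s < t"
      then have "U n (y, s) \<le> ennreal (V (y, s))" using Suc by simp
      then show "0 \<le> enn2real (U n (y, s)) \<and> enn2real (U n (y, s)) \<le> V (y, s)"
        using V by (simp add: enn2real_leI)
    qed
    also have "\<dots> \<le> ennreal (V (x, t))" using super[OF Suc.prems] by (simp add: I_eq)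
    finally show ?case .
  qed (simp add: U_0)
  have U_fin: "U n (x, t) < top" if "0 < t" "t < T" for n x t
    using UV[OF that, of n x] by (rule order.strict_trans1) simp
  have U_mono: "U n (x, t) \<le> U (Suc n) (x, t)" if "0 < t" "t < T" for n x t
    using that
  proof (induction n arbitrary: x t)
    case (Suc n)
    have "I (\<lambda>z. enn2real (U n z)) x t \<le> I (\<lambda>z. enn2real (U (Suc n) z)) x t"
    proof (rule I_mono)
      fix y s assume s: "0 < s" "s < t"
      then show "0 \<le> enn2real (U n (y, s)) \<and> enn2real (U n (y, s)) \<le> enn2real (U (Suc n) (y, s))"
        using Suc.IH[of s y] Suc.prems U_fin[of s "Suc n" y] by (simp add: enn2real_mono)
    qed
    then show ?case unfolding U_I by (rule add_left_mono)
  qed (simp add: U_0)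
  define u where "u z = enn2real (SUP n. U n z)" for z
  have u: "ennreal (u (x, t)) = (SUP n. U n (x, t))" if "0 < t" "t < T" for x t
  proof -
    have "(SUP n. U n (x, t)) \<le> ennreal (V (x, t))" by (intro SUP_least UV that)
    then have "(SUP n. U n (x, t)) < top" by (rule order.strict_trans1) simp
    then show ?thesis by (simp add: u_def)
  qed
  have U_lim: "(\<lambda>n. U n (x, t)) \<longlonglongrightarrow> ennreal (u (x, t))" if "0 < t" "t < T" for x t
    unfolding u[OF that] by (intro LIMSEQ_SUP incseq_SucI U_mono that)
  have eq: "ennreal (u (x, t)) = a (x, t) + I u x t" if t: "0 < t" "t < T" for x t
  proof -
    let ?g = "\<lambda>n s y. ennreal (k (x - y, t - s)) * ennreal (enn2real (U n (y, s)) powr p) * indicator {0<..} s"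
    let ?g' = "\<lambda>s y. ennreal (k (x - y, t - s)) * ennreal (u (y, s) powr p) * indicator {0<..} s"
    have g_mono: "?g n s y \<le> ?g (Suc n) s y" for n s y
    proof (cases "0 < s \<and> s < t")
      case True
      then have "enn2real (U n (y, s)) \<le> enn2real (U (Suc n) (y, s))"
        using t by (intro enn2real_mono U_mono U_fin) auto
      then show ?thesis using p by (intro mult_right_mono mult_left_mono ennreal_leI powr_mono2) auto
    qed (auto simp: k_def)
    have g_lim: "(\<lambda>n. ?g n s y) \<longlonglongrightarrow> ?g' s y" for s y
    proof (cases "0 < s \<and> s < t")
      case True
      have "(\<lambda>n. enn2real (U n (y, s))) \<longlonglongrightarrow> u (y, s)"
        using True t by (intro tendsto_enn2real U_lim) (auto simp: u_def)
      then have "(\<lambda>n. enn2real (U n (y, s)) powr p) \<longlonglongrightarrow> u (y, s) powr p"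
        using p by (intro tendsto_powr') auto
      then have "(\<lambda>n. ennreal (enn2real (U n (y, s)) powr p)) \<longlonglongrightarrow> ennreal (u (y, s) powr p)"
        by (rule tendsto_ennrealI)
      then show ?thesis
        using True by (auto intro!: ennreal_tendsto_cmult)
    qed (auto simp: k_def)
    \<comment> \<open>Monotone convergence is applied twice: here in y for fixed s, afterwards in
      s.\<close>
    have inner: "(\<lambda>n. \<integral>\<^sup>+y. ?g n s y \<partial>lborel) \<longlonglongrightarrow> (\<integral>\<^sup>+y. ?g' s y \<partial>lborel)" for s
      by (rule nn_integral_LIMSEQ)
         (auto intro!: incseq_SucI le_funI g_mono g_lim, measurable)
    have "(\<lambda>n. I (\<lambda>z. enn2real (U n z)) x t) \<longlonglongrightarrow> I u x t"
      unfolding I_def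
      by (rule nn_integral_LIMSEQ)
         (auto intro!: incseq_SucI le_funI nn_integral_mono g_mono inner, measurable)
    then have "(\<lambda>n. U (Suc n) (x, t)) \<longlonglongrightarrow> a (x, t) + I u x t"
      unfolding U_I by (intro tendsto_add tendsto_const)
    then show ?thesis using LIMSEQ_Suc[OF U_lim[OF t, of x]] LIMSEQ_unique by blast
  qed
  show ?thesis
  proof
    show "u \<in> borel_measurable borel" unfolding u_def[abs_def] borel_prod[symmetric] by measurable
    show "u z \<ge> 0" for z by (simp add: u_def)
    show "ennreal (u (x, t)) =
      a (x, t) + (\<integral>\<^sup>+s\<in>{0<..<t}. (\<integral>\<^sup>+y. ennreal (G (x - y) (t - s) * u (y, s) powr p) \<partial>lborel) \<partial>lborel)"
      if "0 < t" "t < T" for x t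
      using eq[OF that] by (simp add: I_eq)
  qed
qed

section \<open>The supersolution for Borel data\<close>

context fractional_heat_kernel
begin

lemma kernel_difference_measurable:
  assumes "t > 0"
  shows "(\<lambda>p. G (fst p - snd p) t) \<in> borel_measurable (borel \<Otimes>\<^sub>M borel)"
proof -
  have [measurable]: "(\<lambda>x. G x t) \<in> borel_measurable borel" by (rule kernel_borel_measurable_space[OF assms])
  show ?thesis
    by (rule measurable_compose[of "\<lambda>p. fst p - snd p" _ borel "\<lambda>x. G x t"]) measurable
qed

definition heat :: "('a \<Rightarrow> ennreal) \<Rightarrow> 'a \<Rightarrow> real \<Rightarrow> ennreal" where
  "heat f x t = (\<integral>\<^sup>+y. ennreal (G (x - y) t) * f y \<partial>lborel)"

lemma heat_semigroup:
  assumes t: "t > 0" and s: "s > 0" and f[measurable]: "f \<in> borel_measurable borel"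
  shows "heat (\<lambda>y. heat f y s) x t = heat f x (t + s)"
proof -
  have [measurable]: "(\<lambda>p. G (fst p - snd p) s) \<in> borel_measurable (borel \<Otimes>\<^sub>M borel)"
    "(\<lambda>y. G (x - y) t) \<in> borel_measurable borel" "(\<lambda>y. G (y - z) s) \<in> borel_measurable borel"
    "(\<lambda>y. G (z - y) s) \<in> borel_measurable borel" for z
    using kernel_difference_measurable[OF s]
      measurable_compose[OF _ kernel_borel_measurable_space[OF t], of "\<lambda>y. x - y"]
      measurable_compose[OF _ kernel_borel_measurable_space[OF s], of "\<lambda>y. y - z"]
      measurable_compose[OF _ kernel_borel_measurable_space[OF s], of "\<lambda>y. z - y"] by auto
  have "heat (\<lambda>y. heat f y s) x t
      = (\<integral>\<^sup>+y. (\<integral>\<^sup>+z. ennreal (G (x - y) t) * ennreal (G (y - z) s) * f z \<partial>lborel) \<partial>lborel)"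
    unfolding heat_def by (intro nn_integral_cong) (simp add: nn_integral_cmult[symmetric] mult.assoc)
  also have "\<dots> = (\<integral>\<^sup>+z. (\<integral>\<^sup>+y. ennreal (G (x - y) t) * ennreal (G (y - z) s) * f z \<partial>lborel) \<partial>lborel)"
    by (rule lborel_pair.Fubini'[symmetric]) measurable
  also have "\<dots> = heat f x (t + s)"
    unfolding heat_def by (intro nn_integral_cong) (simp add: nn_integral_multc kernel_semigroup[OF t s])
  finally show ?thesis .
qed

text \<open>Of the candidate 4 w, the share 2 w for the free evolution comes from
  \<open>le_plus_Psi\<close> and the share 2 w for the Duhamel term from the smallness of \<gamma>.
  The hypothesis has \<open>Psi\<close> on the side of the bound, the form in which
  \<open>kernel_smoothing\<close> can use it.\<close>

lemma supersolution:
  fixes p \<beta> :: real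
  assumes p: "p = 1 + \<theta> / real DIM('a)" and \<beta>: "\<beta> > 0"
  obtains \<gamma> where "\<gamma> > 0"
    "\<And>(\<mu> :: 'a \<Rightarrow> real) T. \<lbrakk>\<mu> \<in> borel_measurable borel; \<And>x. 0 \<le> \<mu> x; T > 0;
      \<And>x \<sigma>. 0 < \<sigma> \<Longrightarrow> \<sigma> < T powr (1 / \<theta>) \<Longrightarrow>
        (\<integral>\<^sup>+y\<in>ball x \<sigma>. ennreal (Psi \<beta> (T powr (1 / (p - 1)) * \<mu> y)) \<partial>lborel)
          \<le> ennreal (Psi \<beta> (\<gamma> * rho DIM('a) \<theta> (\<sigma> * T powr (- (1 / \<theta>))))) * emeasure lborel (ball x \<sigma>)\<rbrakk> \<Longrightarrow>
      \<exists>V. (\<forall>z. 0 \<le> V z) \<and> (\<forall>x t. 0 < t \<longrightarrow> t < T \<longrightarrow>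
        heat (\<lambda>y. ennreal (\<mu> y)) x t
        + (\<integral>\<^sup>+s\<in>{0<..<t}. (\<integral>\<^sup>+y. ennreal (G (x - y) (t - s) * V (y, s) powr p) \<partial>lborel) \<partial>lborel) \<le> ennreal (V (x, t)))"
proof -
  define N where "N = DIM('a)"
  have N: "N \<ge> 1" by (simp add: N_def DIM_positive Suc_leI)
  define \<kappa> where "\<kappa> = \<theta> / N"
  have \<kappa>: "\<kappa> > 0" "p = 1 + \<kappa>" using \<theta> N p by (auto simp: \<kappa>_def N_def)
  obtain C where C: "C \<ge> 1"
    "\<And>t (f :: 'a \<Rightarrow> ennreal) A x. \<lbrakk>t > 0; f \<in> borel_measurable borel;
      \<And>z. (\<integral>\<^sup>+y\<in>ball z (t powr (1 / \<theta>)). f y \<partial>lborel) \<le> A * emeasure lborel (ball z (t powr (1 / \<theta>)))\<rbrakk>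
      \<Longrightarrow> heat f x t \<le> ennreal C * A"
    unfolding heat_def using kernel_smoothing by blast
  obtain K where K: "K > 0"
    "\<And>c \<tau> W. 0 < c \<Longrightarrow> c \<le> 1 \<Longrightarrow> 0 < \<tau> \<Longrightarrow> \<tau> < 1 \<Longrightarrow> 0 \<le> W \<Longrightarrow> W \<le> c * rho N \<theta> (\<tau> powr (1 / \<theta>)) \<Longrightarrow>
       W powr \<kappa> * ln (exp 1 + W) powr (- \<beta>)
         \<le> K * c powr (\<kappa> / 2) * (1 / \<tau> * log_weight \<theta> \<tau> powr (- 1 - \<beta>))"
    "\<And>c \<tau> W. 0 < c \<Longrightarrow> c \<le> 1 \<Longrightarrow> 0 < \<tau> \<Longrightarrow> \<tau> < 1 \<Longrightarrow> 0 \<le> W \<Longrightarrow> W \<le> c * rho N \<theta> (\<tau> powr (1 / \<theta>)) \<Longrightarrow>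
       ln (exp 1 + W) powr \<beta> \<le> K * log_weight \<theta> \<tau> powr \<beta>"
    using supersolution_weight[OF \<theta>(1) N \<beta>] unfolding \<kappa>_def by blast
  \<comment> \<open>The Duhamel term will come out as at most Q m (w / M), where m is
    c^(\<kappa>/2); hence the requirement m \<le> 2 / Q. The two factors K stem from the two
    estimates of \<open>supersolution_weight\<close>, and \<theta> / \<beta> from the time
    integral.\<close>
  define Q where "Q = 4 powr p * K\<^sup>2 * (\<theta> / \<beta>)"
  have Q: "Q > 0" using K(1) \<theta> \<beta> by (simp add: Q_def)
  define m where "m = min 1 (2 / Q)"
  have "Q * m \<le> Q * (2 / Q)" using Q by (intro mult_left_mono) (auto simp: m_def)
  then have m: "m > 0" "m \<le> 1" "Q * m \<le> 2" using Q by (auto simp: m_def)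
  define c where "c = m powr (2 / \<kappa>)"
  have c: "0 < c" "c \<le> 1" "c powr (\<kappa> / 2) = m"
    using m \<kappa> by (auto simp: c_def powr_powr powr_le1)
  \<comment> \<open>The smoothing estimate loses the factor C, which \<open>mult_Psi_le\<close>
    moves into the argument of \<open>Psi\<close>.\<close>
  define \<gamma> where "\<gamma> = c / C"
  have \<gamma>: "\<gamma> > 0" "C * \<gamma> = c" using c C by (auto simp: \<gamma>_def)
  show ?thesis
  proof (rule that[OF \<gamma>(1)])
    fix \<mu> :: "'a \<Rightarrow> real" and T :: real
    assume \<mu>[measurable]: "\<mu> \<in> borel_measurable borel" and \<mu>0: "\<And>x. 0 \<le> \<mu> x" and T: "T > 0"
      and ball: "\<And>x \<sigma>. 0 < \<sigma> \<Longrightarrow> \<sigma> < T powr (1 / \<theta>) \<Longrightarrow>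
        (\<integral>\<^sup>+y\<in>ball x \<sigma>. ennreal (Psi \<beta> (T powr (1 / (p - 1)) * \<mu> y)) \<partial>lborel)
          \<le> ennreal (Psi \<beta> (\<gamma> * rho DIM('a) \<theta> (\<sigma> * T powr (- (1 / \<theta>))))) * emeasure lborel (ball x \<sigma>)"
    \<comment> \<open>Here M^(p-1) = T, hence M^p = M T; this T is cancelled by the factor T of
      \<open>log_weight_integral\<close>.\<close>
    define M where "M = T powr (1 / \<kappa>)"
    have M: "M > 0" "M powr p = M * T" "T powr (1 / (p - 1)) = M"
      using T \<kappa> by (auto simp: M_def powr_add powr_powr)
    define f where "f y = ennreal (Psi \<beta> (M * \<mu> y))" for y
    have f[measurable]: "f \<in> borel_measurable borel"
      unfolding f_def[abs_def] using Psi_measurable[OF \<beta>] by measurable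
    define R where "R t = rho N \<theta> ((t / T) powr (1 / \<theta>))" for t
    have R0: "R t \<ge> 0" for t by (simp add: R_def rho_def)
    have F_le: "heat f x t \<le> ennreal (Psi \<beta> (c * R t))" if t: "0 < t" "t < T" for x t
    proof -
      have "t powr (1 / \<theta>) * T powr (- (1 / \<theta>)) = (t / T) powr (1 / \<theta>)"
        using t T by (simp add: powr_divide powr_minus_divide)
      moreover have "t powr (1 / \<theta>) < T powr (1 / \<theta>)"
        using t \<theta> by (intro powr_less_mono2) auto
      ultimately have "heat f x t \<le> ennreal C * ennreal (Psi \<beta> (\<gamma> * R t))"
        using ball[of "t powr (1 / \<theta>)"] t \<theta> unfolding f_def M(3)[symmetric] R_def N_def
        by (intro C(2)) (auto simp: f_def[symmetric, abs_def] M(3))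
      also have "\<dots> = ennreal (C * Psi \<beta> (\<gamma> * R t))" using C(1) by (simp add: ennreal_mult')
      also have "\<dots> \<le> ennreal (Psi \<beta> (c * R t))"
        using mult_Psi_le[OF \<beta> C(1), of "\<gamma> * R t"] \<gamma> R0[of t] by (intro ennreal_leI) (simp add: mult.assoc[symmetric])
      finally show ?thesis .
    qed
    define F where "F x t = enn2real (heat f x t)" for x t
    have F: "heat f x t = ennreal (F x t)" "0 \<le> F x t" "F x t \<le> Psi \<beta> (c * R t)" if t: "0 < t" "t < T" for x t
    proof -
      have "heat f x t < top" using F_le[OF t, of x] by (rule order.strict_trans1) simp
      then show "heat f x t = ennreal (F x t)" by (simp add: F_def)
      show "F x t \<le> Psi \<beta> (c * R t)"
        unfolding F_def using F_le[OF t, of x] c R0[of t] by (intro enn2real_leI Psi_nonneg[OF \<beta>]) auto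
    qed (simp add: F_def)
    define W where "W x t = Psi_inverse \<beta> (F x t)" for x t
    have W: "0 \<le> W x t" "W x t \<le> c * R t" "F x t = W x t * ln (exp 1 + W x t) powr \<beta>" if t: "0 < t" "t < T" for x t
      using Psi_inverse_nonneg[OF \<beta> F(2)[OF t]] Psi_Psi_inverse[OF \<beta> F(2)[OF t], of x]
        Psi_inverse_le_iff[OF \<beta> F(2)[OF t], of "c * R t" x] F(3)[OF t, of x] c R0[of t]
      by (auto simp: W_def Psi_def)
    define V where "V z = (if 0 < snd z \<and> snd z < T then 4 * (W (fst z) (snd z) / M) else 0)" for z
    define \<psi> where "\<psi> s = 1 / (s / T) * log_weight \<theta> (s / T) powr (- 1 - \<beta>)" for s
    have \<psi>0: "\<psi> s \<ge> 0" if "s > 0" for s using that T by (simp add: \<psi>_def)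
    have [measurable]: "\<psi> \<in> borel_measurable borel" unfolding \<psi>_def[abs_def] log_weight_def by measurable
    \<comment> \<open>One factor W is traded for F ln(e + W)^(-\<beta>), which bounds the source by
      a function of s times F, an expression linear in \<open>f\<close>.\<close>
    have Vp: "V (y, s) powr p \<le> 4 powr p * K * m / (M * T) * \<psi> s * F y s" if s: "0 < s" "s < T" for y s
    proof -
      have w: "0 \<le> W y s" "W y s \<le> c * R s" "F y s = W y s * ln (exp 1 + W y s) powr \<beta>" using W[OF s] by auto
      have l: "ln (exp 1 + W y s) powr (- \<beta>) * ln (exp 1 + W y s) powr \<beta> = 1"
        using ln_exp1_plus_ge_1[OF w(1)] by (simp add: powr_add[symmetric])
      have "V (y, s) powr p = 4 powr p / (M * T) * W y s powr p"
        using s w M by (simp add: V_def powr_mult powr_divide)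
      also have "W y s powr p = W y s powr \<kappa> * ln (exp 1 + W y s) powr (- \<beta>) * F y s"
      proof -
        have "W y s powr p = W y s powr \<kappa> * W y s" using w(1) by (simp add: \<kappa>(2) powr_add mult.commute)
        also have "\<dots> = W y s powr \<kappa> * W y s * (ln (exp 1 + W y s) powr (- \<beta>) * ln (exp 1 + W y s) powr \<beta>)"
          unfolding l by simp
        finally show ?thesis unfolding w(3) by (simp only: mult_ac)
      qed
      also have "4 powr p / (M * T) * (W y s powr \<kappa> * ln (exp 1 + W y s) powr (- \<beta>) * F y s)
          \<le> 4 powr p / (M * T) * (K * m * \<psi> s * F y s)"
      proof (intro mult_left_mono mult_right_mono)
        show "W y s powr \<kappa> * ln (exp 1 + W y s) powr (- \<beta>) \<le> K * m * \<psi> s"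
          using K(2)[OF c(1,2), of "s / T" "W y s"] w s T by (simp only: \<psi>_def c(3) R_def) simp
      qed (use F(2)[OF s] M T in auto)
      finally show ?thesis by (simp add: mult_ac)
    qed
    show "\<exists>V. (\<forall>z. 0 \<le> V z) \<and> (\<forall>x t. 0 < t \<longrightarrow> t < T \<longrightarrow>
        heat (\<lambda>y. ennreal (\<mu> y)) x t
        + (\<integral>\<^sup>+s\<in>{0<..<t}. (\<integral>\<^sup>+y. ennreal (G (x - y) (t - s) * V (y, s) powr p) \<partial>lborel) \<partial>lborel) \<le> ennreal (V (x, t)))"
    proof (intro exI[of _ V] conjI allI impI)
      show "0 \<le> V z" for z using W(1)[of "snd z" "fst z"] M by (auto simp: V_def)
      fix x :: 'a and t assume t: "0 < t" "t < T"
      define w where "w = W x t"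
      have w: "0 \<le> w" "w \<le> c * R t" "F x t = w * ln (exp 1 + w) powr \<beta>" using W[OF t, of x] by (auto simp: w_def)
      have l: "ln (exp 1 + w) powr \<beta> \<ge> 1" by (rule ln_powr_ge_1[OF \<beta> w(1)])
      have [measurable]: "(\<lambda>y. G (x - y) t) \<in> borel_measurable borel"
        by (rule measurable_compose[OF _ kernel_borel_measurable_space[OF t(1)]]) measurable
      have mass: "(\<integral>\<^sup>+y. ennreal (G (x - y) t) \<partial>lborel) = 1"
        using nn_integral_lborel_affine[of "- 1" "\<lambda>y. ennreal (G y t)" x] kernel_mass[OF t(1)]
          kernel_borel_measurable_space[OF t(1)] by simp
      \<comment> \<open>The splitting threshold is the value w at the fixed point (x, t).
        Integration against the unit-mass kernel yields w / M plus F / (M ln(e + w)^\<beta>), and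
        the second term is again w / M.\<close>
      have lin: "heat (\<lambda>y. ennreal (\<mu> y)) x t \<le> ennreal (2 * (w / M))"
      proof -
        have "heat (\<lambda>y. ennreal (\<mu> y)) x t
            \<le> (\<integral>\<^sup>+y. ennreal (G (x - y) t) * ennreal (w / M)
              + ennreal (1 / (M * ln (exp 1 + w) powr \<beta>)) * (ennreal (G (x - y) t) * f y) \<partial>lborel)"
          unfolding heat_def
        proof (intro nn_integral_mono)
          fix y
          have "M * \<mu> y \<le> w + Psi \<beta> (M * \<mu> y) / ln (exp 1 + w) powr \<beta>"
            using M \<mu>0 w by (intro le_plus_Psi[OF \<beta>]) auto
          then have "\<mu> y \<le> w / M + 1 / (M * ln (exp 1 + w) powr \<beta>) * Psi \<beta> (M * \<mu> y)"
            using M by (simp add: field_simps)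
          then have "ennreal (\<mu> y) \<le> ennreal (w / M + 1 / (M * ln (exp 1 + w) powr \<beta>) * Psi \<beta> (M * \<mu> y))"
            by (rule ennreal_leI)
          also have "\<dots> = ennreal (w / M) + ennreal (1 / (M * ln (exp 1 + w) powr \<beta>)) * f y"
            unfolding f_def using M \<mu>0[of y] w Psi_nonneg[OF \<beta>, of "M * \<mu> y"]
            by (simp add: ennreal_mult[symmetric])
          finally have "ennreal (G (x - y) t) * ennreal (\<mu> y)
              \<le> ennreal (G (x - y) t) * (ennreal (w / M) + ennreal (1 / (M * ln (exp 1 + w) powr \<beta>)) * f y)"
            by (rule mult_left_mono) simp
          then show "ennreal (G (x - y) t) * ennreal (\<mu> y) \<le> ennreal (G (x - y) t) * ennreal (w / M)
              + ennreal (1 / (M * ln (exp 1 + w) powr \<beta>)) * (ennreal (G (x - y) t) * f y)"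
            by (simp only: distrib_left mult_ac)
        qed
        also have "\<dots> = ennreal (w / M) + ennreal (1 / (M * ln (exp 1 + w) powr \<beta>)) * heat f x t"
          by (simp add: nn_integral_add nn_integral_cmult nn_integral_multc mass heat_def)
        also have "\<dots> = ennreal (w / M + 1 / (M * ln (exp 1 + w) powr \<beta>) * F x t)"
          unfolding F(1)[OF t] using M w(1) F(2)[OF t, of x] by (simp add: ennreal_mult[symmetric])
        also have "w / M + 1 / (M * ln (exp 1 + w) powr \<beta>) * F x t = 2 * (w / M)"
          using l M ln_exp1_plus_ge_1[OF w(1)] by (simp add: w(3))
        finally show ?thesis .
      qed
      define D where "D = 4 powr p * K * m / (M * T)"
      have D: "D \<ge> 0" using K m M T by (simp add: D_def)
      have "(\<integral>\<^sup>+s\<in>{0<..<t}. (\<integral>\<^sup>+y. ennreal (G (x - y) (t - s) * V (y, s) powr p) \<partial>lborel) \<partial>lborel)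
          \<le> (\<integral>\<^sup>+s. ennreal D * heat f x t * (ennreal (\<psi> s) * indicator {0<..<t} s) \<partial>lborel)"
      proof (intro nn_integral_mono)
        fix s
        show "(\<integral>\<^sup>+y. ennreal (G (x - y) (t - s) * V (y, s) powr p) \<partial>lborel) * indicator {0<..<t} s
            \<le> ennreal D * heat f x t * (ennreal (\<psi> s) * indicator {0<..<t} s)"
        proof (cases "0 < s \<and> s < t")
          case True
          then have s: "0 < s" "s < T" "0 < t - s" using t by auto
          have m1[measurable]: "(\<lambda>y. G (x - y) (t - s)) \<in> borel_measurable borel"
            by (rule measurable_compose[OF _ kernel_borel_measurable_space[OF s(3)]]) measurable
          have [measurable]: "(\<lambda>y. heat f y s) \<in> borel_measurable borel"
          proof -
            have [measurable]: "(\<lambda>p. G (fst p - snd p) s) \<in> borel_measurable (borel \<Otimes>\<^sub>M borel)"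
              by (rule kernel_difference_measurable[OF s(1)])
            show ?thesis unfolding heat_def by measurable
          qed
          have "(\<integral>\<^sup>+y. ennreal (G (x - y) (t - s) * V (y, s) powr p) \<partial>lborel)
              \<le> (\<integral>\<^sup>+y. ennreal (D * \<psi> s) * (ennreal (G (x - y) (t - s)) * heat f y s) \<partial>lborel)"
          proof (intro nn_integral_mono)
            fix y
            have "G (x - y) (t - s) * V (y, s) powr p \<le> G (x - y) (t - s) * (D * \<psi> s * F y s)"
              using Vp[OF s(1,2), of y] kernel_pos[OF s(3), of "x - y"] by (intro mult_left_mono) (auto simp: D_def)
            then have "ennreal (G (x - y) (t - s) * V (y, s) powr p) \<le> ennreal (G (x - y) (t - s) * (D * \<psi> s * F y s))"
              by (rule ennreal_leI)
            also have "\<dots> = ennreal (D * \<psi> s) * (ennreal (G (x - y) (t - s)) * heat f y s)"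
              unfolding F(1)[OF s(1,2)]
              using D \<psi>0[OF s(1)] F(2)[OF s(1,2), of y] kernel_pos[OF s(3), of "x - y"]
              by (simp add: ennreal_mult mult_ac)
            finally show "ennreal (G (x - y) (t - s) * V (y, s) powr p)
              \<le> ennreal (D * \<psi> s) * (ennreal (G (x - y) (t - s)) * heat f y s)" .
          qed
          also have "\<dots> = ennreal (D * \<psi> s) * heat (\<lambda>y. heat f y s) x (t - s)"
            unfolding heat_def[of "\<lambda>y. heat f y s"] by (rule nn_integral_cmult) measurable
          \<comment> \<open>Evolving for the remaining time t - s gives the value at time t,
            independent of s, so only the weight is left to integrate.\<close>
          also have "\<dots> = ennreal (D * \<psi> s) * heat f x t"
            by (simp add: heat_semigroup[OF s(3) s(1) f])
          finally show ?thesis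
            using True D \<psi>0[OF s(1)] by (simp add: ennreal_mult mult_ac)
        qed simp
      qed
      also have "\<dots> = ennreal D * heat f x t * (\<integral>\<^sup>+s\<in>{0<..<t}. ennreal (\<psi> s) \<partial>lborel)"
        by (rule nn_integral_cmult) measurable
      also have "\<dots> \<le> ennreal D * heat f x t * ennreal (T * (\<theta> / \<beta>) * log_weight \<theta> (t / T) powr (- \<beta>))"
        unfolding \<psi>_def using t by (intro mult_left_mono log_weight_integral \<theta> \<beta>) auto
      also have "\<dots> = ennreal (D * F x t * (T * (\<theta> / \<beta>) * log_weight \<theta> (t / T) powr (- \<beta>)))"
        unfolding F(1)[OF t] using D F(2)[OF t, of x] T \<theta> \<beta> by (simp add: ennreal_mult[symmetric])
      also have "\<dots> \<le> ennreal (2 * (w / M))"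
      proof (rule ennreal_leI)
        define L where "L = log_weight \<theta> (t / T)"
        have L: "L \<ge> 1" using log_weight_ge_1[OF \<theta>(1), of "t / T"] t T by (simp add: L_def)
        \<comment> \<open>Returning from F to w costs L^\<beta>, exactly the power that the time
          integral has gained.\<close>
        have "F x t \<le> w * (K * L powr \<beta>)"
          unfolding w(3) L_def using K(3)[OF c(1,2), of "t / T" w] w t T
          by (intro mult_left_mono) (auto simp: R_def)
        then have "D * F x t * (T * (\<theta> / \<beta>) * L powr (- \<beta>)) \<le> D * (w * (K * L powr \<beta>)) * (T * (\<theta> / \<beta>) * L powr (- \<beta>))"
          using D T \<theta> \<beta> by (intro mult_right_mono mult_left_mono) auto
        also have "\<dots> = D * w * K * T * (\<theta> / \<beta>) * (L powr \<beta> * L powr (- \<beta>))" by (simp only: mult_ac)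
        also have "L powr \<beta> * L powr (- \<beta>) = 1" using L by (simp add: powr_add[symmetric])
        also have "D * w * K * T * (\<theta> / \<beta>) * 1 = (Q * m) * (w / M)"
          using T M by (simp add: D_def Q_def power2_eq_square mult_ac)
        also have "\<dots> \<le> 2 * (w / M)" using m(3) w M by (intro mult_right_mono) auto
        finally show "D * F x t * (T * (\<theta> / \<beta>) * log_weight \<theta> (t / T) powr (- \<beta>)) \<le> 2 * (w / M)"
          unfolding L_def .
      qed
      finally have "heat (\<lambda>y. ennreal (\<mu> y)) x t
        + (\<integral>\<^sup>+s\<in>{0<..<t}. (\<integral>\<^sup>+y. ennreal (G (x - y) (t - s) * V (y, s) powr p) \<partial>lborel) \<partial>lborel)
        \<le> ennreal (2 * (w / M)) + ennreal (2 * (w / M))"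
        by (intro add_mono lin)
      also have "\<dots> = ennreal (V (x, t))"
        using t w M by (simp add: V_def w_def[symmetric] ennreal_plus[symmetric] del: ennreal_plus)
      finally show "heat (\<lambda>y. ennreal (\<mu> y)) x t
        + (\<integral>\<^sup>+s\<in>{0<..<t}. (\<integral>\<^sup>+y. ennreal (G (x - y) (t - s) * V (y, s) powr p) \<partial>lborel) \<partial>lborel) \<le> ennreal (V (x, t))" .
    qed
  qed
qed

end

section \<open>Lebesgue measurable data and the conclusion\<close>

lemma Psi_inv_average_leD:
  fixes f :: "'a::euclidean_space \<Rightarrow> real"
  assumes \<beta>: "\<beta> > 0" and \<sigma>: "\<sigma> > 0" and b: "b \<ge> 0"
    and le: "Psi_inv \<beta> (average f (ball x \<sigma>)) \<le> ennreal b"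
  shows "(\<integral>\<^sup>+y\<in>ball x \<sigma>. ennreal (f y) \<partial>lebesgue) \<le> ennreal (Psi \<beta> b) * emeasure lebesgue (ball x \<sigma>)"
proof -
  define A where "A = average f (ball x \<sigma>)"
  \<comment> \<open>A finite bound excludes an infinite average because \<open>Psi_inv\<close> sends
    infinity to infinity; \<open>enn2real\<close> alone would turn it into 0.\<close>
  have "A \<noteq> \<infinity>" using le by (auto simp: A_def Psi_inv_def top_unique split: if_splits)
  then have A: "A = ennreal (enn2real A)" by (simp add: ennreal_enn2real_if)
  have "Psi_inverse \<beta> (enn2real A) \<le> b"
    using le \<open>A \<noteq> \<infinity>\<close> b by (simp add: A_def[symmetric] Psi_inv_def Psi_inverse_def)
  then have "A \<le> ennreal (Psi \<beta> b)"
    using Psi_inverse_le_iff[OF \<beta>, of "enn2real A" b] b by (subst A) (simp add: ennreal_leI)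
  moreover have "(\<integral>\<^sup>+y\<in>ball x \<sigma>. ennreal (f y) \<partial>lebesgue) = A * emeasure lebesgue (ball x \<sigma>)"
  proof -
    define r where "r = unit_ball_vol DIM('a) * \<sigma> ^ DIM('a)"
    have "r > 0" using \<sigma> by (simp add: r_def)
    moreover have "emeasure lebesgue (ball x \<sigma>) = ennreal r" using \<sigma> by (simp add: emeasure_ball r_def)
    ultimately show ?thesis
      unfolding A_def average_def by (simp add: ennreal_divide_times ennreal_times_divide[symmetric] divide_ennreal)
  qed
  ultimately show ?thesis by (simp add: mult_right_mono)
qed

theorem theorem1p5:
  fixes G :: "'a::euclidean_space \<Rightarrow> real \<Rightarrow> real"
    and \<theta> p \<beta> :: real
  assumes "0 < \<theta>" and "\<theta> \<le> 2"
    and "p = 1 + \<theta> / real DIM('a)"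
    and "\<beta> > 0"
    and "fundamental_solution \<theta> G"
  shows "\<exists>\<gamma>\<^sub>4>0. \<forall>(\<mu> :: 'a \<Rightarrow> real) (T :: real).
    \<mu> \<in> borel_measurable lebesgue \<longrightarrow> (\<forall>x. 0 \<le> \<mu> x) \<longrightarrow> T > 0 \<longrightarrow>
    (\<forall>\<sigma>. 0 < \<sigma> \<and> \<sigma> < T powr (1 / \<theta>) \<longrightarrow>
       (SUP x. Psi_inv \<beta> (average (\<lambda>y. Psi \<beta> (T powr (1 / (p - 1)) * \<mu> y)) (ball x \<sigma>)))
         \<le> ennreal (\<gamma>\<^sub>4 * rho DIM('a) \<theta> (\<sigma> * T powr (- (1 / \<theta>))))) \<longrightarrow>
    (\<exists>u. cauchy_solution G p (function_measure \<mu>) (ereal T) u)"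
proof -
  interpret fractional_heat_kernel G \<theta> using assms by unfold_locales auto
  note \<beta> = assms(4)
  have p: "p > 0" using assms by (simp add: add_pos_nonneg)
  obtain \<gamma> where \<gamma>: "\<gamma> > 0" and
    super: "\<And>(\<mu> :: 'a \<Rightarrow> real) T. \<lbrakk>\<mu> \<in> borel_measurable borel; \<And>x. 0 \<le> \<mu> x; T > 0;
      \<And>x \<sigma>. 0 < \<sigma> \<Longrightarrow> \<sigma> < T powr (1 / \<theta>) \<Longrightarrow>
        (\<integral>\<^sup>+y\<in>ball x \<sigma>. ennreal (Psi \<beta> (T powr (1 / (p - 1)) * \<mu> y)) \<partial>lborel)
          \<le> ennreal (Psi \<beta> (\<gamma> * rho DIM('a) \<theta> (\<sigma> * T powr (- (1 / \<theta>))))) * emeasure lborel (ball x \<sigma>)\<rbrakk> \<Longrightarrow>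
      \<exists>V. (\<forall>z. 0 \<le> V z) \<and> (\<forall>x t. 0 < t \<longrightarrow> t < T \<longrightarrow>
        heat (\<lambda>y. ennreal (\<mu> y)) x t
        + (\<integral>\<^sup>+s\<in>{0<..<t}. (\<integral>\<^sup>+y. ennreal (G (x - y) (t - s) * V (y, s) powr p) \<partial>lborel) \<partial>lborel) \<le> ennreal (V (x, t)))"
    using supersolution[OF assms(3,4)] by blast
  show ?thesis
  proof (intro exI[of _ \<gamma>] conjI \<gamma> allI impI)
    fix \<mu> :: "'a \<Rightarrow> real" and T :: real
    assume \<mu>: "\<mu> \<in> borel_measurable lebesgue" and \<mu>0: "\<forall>x. 0 \<le> \<mu> x" and T: "T > 0"
      and bound: "\<forall>\<sigma>. 0 < \<sigma> \<and> \<sigma> < T powr (1 / \<theta>) \<longrightarrow>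
       (SUP x. Psi_inv \<beta> (average (\<lambda>y. Psi \<beta> (T powr (1 / (p - 1)) * \<mu> y)) (ball x \<sigma>)))
         \<le> ennreal (\<gamma> * rho DIM('a) \<theta> (\<sigma> * T powr (- (1 / \<theta>))))"
    \<comment> \<open>The kernel estimates are stated for Borel functions. A Borel version of \<mu>,
      truncated below at 0 so that it is nonnegative everywhere, has the same integrals.\<close>
    obtain \<mu>1 where \<mu>1: "\<mu>1 \<in> borel_measurable lborel" "AE x in lborel. \<mu> x = \<mu>1 x"
      using completion_ex_borel_measurable_real[OF \<mu>] by blast
    define \<nu> where "\<nu> x = max 0 (\<mu>1 x)" for x
    have \<nu>[measurable]: "\<nu> \<in> borel_measurable borel" and \<nu>0: "\<And>x. 0 \<le> \<nu> x"
      using \<mu>1(1) by (auto simp: \<nu>_def[abs_def])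
    have \<mu>\<nu>: "AE x in lborel. \<mu> x = \<nu> x"
      using \<mu>1(2)
    proof eventually_elim
      case (elim x)
      then show ?case using \<mu>0[rule_format, of x] by (simp add: \<nu>_def)
    qed
    have ball: "(\<integral>\<^sup>+y\<in>ball x \<sigma>. ennreal (Psi \<beta> (T powr (1 / (p - 1)) * \<nu> y)) \<partial>lborel)
          \<le> ennreal (Psi \<beta> (\<gamma> * rho DIM('a) \<theta> (\<sigma> * T powr (- (1 / \<theta>))))) * emeasure lborel (ball x \<sigma>)"
      if \<sigma>: "0 < \<sigma>" "\<sigma> < T powr (1 / \<theta>)" for x \<sigma>
    proof -
      have "Psi_inv \<beta> (average (\<lambda>y. Psi \<beta> (T powr (1 / (p - 1)) * \<mu> y)) (ball x \<sigma>))
          \<le> ennreal (\<gamma> * rho DIM('a) \<theta> (\<sigma> * T powr (- (1 / \<theta>))))"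
        by (rule order_trans[OF SUP_upper[OF UNIV_I] bound[rule_format, OF conjI[OF \<sigma>]]])
      from Psi_inv_average_leD[OF \<beta> \<sigma>(1) _ this]
      have "(\<integral>\<^sup>+y\<in>ball x \<sigma>. ennreal (Psi \<beta> (T powr (1 / (p - 1)) * \<mu> y)) \<partial>lebesgue)
          \<le> ennreal (Psi \<beta> (\<gamma> * rho DIM('a) \<theta> (\<sigma> * T powr (- (1 / \<theta>))))) * emeasure lebesgue (ball x \<sigma>)"
        using \<gamma> by (simp add: rho_def)
      also have "(\<integral>\<^sup>+y\<in>ball x \<sigma>. ennreal (Psi \<beta> (T powr (1 / (p - 1)) * \<mu> y)) \<partial>lebesgue)
          = (\<integral>\<^sup>+y\<in>ball x \<sigma>. ennreal (Psi \<beta> (T powr (1 / (p - 1)) * \<nu> y)) \<partial>lborel)"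
        unfolding nn_integral_completion by (intro nn_integral_cong_AE, use \<mu>\<nu> in eventually_elim) simp
      finally show ?thesis by simp
    qed
    obtain V where V: "\<And>z. 0 \<le> V z" "\<And>x t. 0 < t \<Longrightarrow> t < T \<Longrightarrow>
        heat (\<lambda>y. ennreal (\<nu> y)) x t
        + (\<integral>\<^sup>+s\<in>{0<..<t}. (\<integral>\<^sup>+y. ennreal (G (x - y) (t - s) * V (y, s) powr p) \<partial>lborel) \<partial>lborel) \<le> ennreal (V (x, t))"
      using super[OF \<nu> \<nu>0 T ball] by blast
    \<comment> \<open>The free evolution with the kernel extended by 0 to nonpositive times, which
      makes it Borel measurable in (x, t) jointly.\<close>
    define a where "a z = (\<integral>\<^sup>+y. ennreal (if snd z > 0 then G (fst z - y) (snd z) else 0) * ennreal (\<nu> y) \<partial>lborel)" for z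
    have a_heat: "a (x, t) = heat (\<lambda>y. ennreal (\<nu> y)) x t" if "t > 0" for x t
      using that by (simp add: a_def heat_def)
    have a: "a \<in> borel_measurable borel"
    proof -
      have [measurable]: "(\<lambda>z::'a \<times> real. if snd z > 0 then G (fst z) (snd z) else 0) \<in> borel_measurable (borel \<Otimes>\<^sub>M borel)"
        using kernel_borel_measurable unfolding borel_prod .
      have "(\<lambda>q::('a \<times> real) \<times> 'a. if snd (fst q) > 0 then G (fst (fst q) - snd q) (snd (fst q)) else 0)
          \<in> borel_measurable ((borel \<Otimes>\<^sub>M borel) \<Otimes>\<^sub>M borel)"
        using measurable_compose[of "\<lambda>q::('a \<times> real) \<times> 'a. (fst (fst q) - snd q, snd (fst q))" "(borel \<Otimes>\<^sub>M borel) \<Otimes>\<^sub>M borel"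
          "borel \<Otimes>\<^sub>M borel" "\<lambda>z. if snd z > 0 then G (fst z) (snd z) else 0" borel] by (simp cong: if_cong)
      then have [measurable]: "(\<lambda>q::('a \<times> real) \<times> 'a. if snd (fst q) > 0 then G (fst (fst q) - snd q) (snd (fst q)) else 0)
          \<in> borel_measurable (borel \<Otimes>\<^sub>M borel)" unfolding borel_prod[where 'a = 'a and 'b = real] .
      show ?thesis unfolding a_def[abs_def] by (rule lborel.borel_measurable_nn_integral) (simp add: split_beta')
    qed
    obtain u :: "'a \<times> real \<Rightarrow> real" where u: "u \<in> borel_measurable borel" "\<And>z. u z \<ge> 0"
      "\<And>x t. 0 < t \<Longrightarrow> t < T \<Longrightarrow> ennreal (u (x, t)) =
      a (x, t) + (\<integral>\<^sup>+s\<in>{0<..<t}. (\<integral>\<^sup>+y. ennreal (G (x - y) (t - s) * u (y, s) powr p) \<partial>lborel) \<partial>lborel)"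
      by (rule integral_equation_of_supersolution[OF p kernel_borel_measurable a V(1), where T = T])
         (use V(2) in \<open>simp_all add: a_heat\<close>)
    have id: "(\<lambda>x. x) \<in> measurable (density lebesgue (\<lambda>x. ennreal (\<mu> x))) (borel :: 'a measure)"
      by (simp add: measurable_completion)
    have fm: "(\<integral>\<^sup>+y. g y \<partial>function_measure \<mu>) = (\<integral>\<^sup>+y. g y * ennreal (\<nu> y) \<partial>lborel)"
      if g[measurable]: "g \<in> borel_measurable borel" for g :: "'a \<Rightarrow> ennreal"
    proof -
      have "(\<integral>\<^sup>+y. g y \<partial>function_measure \<mu>) = (\<integral>\<^sup>+y. ennreal (\<mu> y) * g y \<partial>lebesgue)"
        unfolding function_measure_def using \<mu> g
        by (subst nn_integral_distr[OF id]) (auto simp: nn_integral_density measurable_completion)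
      also have "\<dots> = (\<integral>\<^sup>+y. g y * ennreal (\<nu> y) \<partial>lborel)"
        unfolding nn_integral_completion
        by (intro nn_integral_cong_AE, use \<mu>\<nu> in eventually_elim) (simp add: mult.commute)
      finally show ?thesis .
    qed
    have heat_fm: "(\<integral>\<^sup>+y. ennreal (G (x - y) t) \<partial>function_measure \<mu>) = heat (\<lambda>y. ennreal (\<nu> y)) x t" if t: "t > 0" for x t
    proof -
      have [measurable]: "(\<lambda>y. G (x - y) t) \<in> borel_measurable borel"
        by (rule measurable_compose[OF _ kernel_borel_measurable_space[OF t]]) measurable
      show ?thesis unfolding heat_def by (rule fm) measurable
    qed
    \<comment> \<open>Local finiteness is read off from the supersolution: on a nonempty compact set
      the kernel at time T / 2 has a positive minimum, while its integral against the measure is at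
      most the finite value of \<open>V\<close> at the origin and that time.\<close>
    have "radon_measure (function_measure \<mu>)"
      unfolding radon_measure_def
    proof (intro conjI allI impI)
      show s: "sets (function_measure \<mu>) = sets borel" by (simp add: function_measure_def)
      fix S :: "'a set" assume S: "compact S"
      define t where "t = T / 2"
      have t: "0 < t" "t < T" using T by (auto simp: t_def)
      show "emeasure (function_measure \<mu>) S < \<infinity>"
      proof (cases "S = {}")
        case False
        have "continuous_on S (\<lambda>y. G (0 - y) t)"
          by (rule continuous_on_compose2[OF kernel_continuous_space[OF t(1)]]) (auto intro!: continuous_intros)
        from continuous_attains_inf[OF S False this] obtain y0 where
          y0: "\<And>y. y \<in> S \<Longrightarrow> G (0 - y0) t \<le> G (0 - y) t" by blast
        define \<epsilon> where "\<epsilon> = G (0 - y0) t"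
        have \<epsilon>: "\<epsilon> > 0" unfolding \<epsilon>_def by (rule kernel_pos[OF t(1)])
        have [measurable]: "S \<in> sets borel" using S by (simp add: borel_compact)
        have "ennreal \<epsilon> * emeasure (function_measure \<mu>) S = (\<integral>\<^sup>+y. ennreal \<epsilon> * indicator S y \<partial>function_measure \<mu>)"
          by (rule nn_integral_cmult_indicator[symmetric]) (simp add: s)
        also have "\<dots> \<le> (\<integral>\<^sup>+y. ennreal (G (0 - y) t) \<partial>function_measure \<mu>)"
          by (intro nn_integral_mono) (auto simp: indicator_def \<epsilon>_def y0[simplified] intro!: ennreal_leI)
        also have "\<dots> = heat (\<lambda>y. ennreal (\<nu> y)) 0 t" by (rule heat_fm[OF t(1)])
        also have "\<dots> \<le> ennreal (V (0, t))" using V(2)[OF t, of 0] by (rule order_trans[rotated]) simp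
        also have "\<dots> < \<infinity>" by simp
        finally show ?thesis using \<epsilon> by (auto simp: ennreal_mult_less_top)
      qed simp
    qed
    then show "\<exists>u. cauchy_solution G p (function_measure \<mu>) (ereal T) u"
      unfolding cauchy_solution_def
    proof (intro exI[of _ u] conjI)
      show "u \<in> borel_measurable (lebesgue_on (UNIV \<times> {t. 0 < t \<and> ereal t < ereal T}))"
        using u(1) by (intro measurable_restrict_space1 measurable_completion) simp
      show "\<forall>x t. 0 < t \<and> ereal t < ereal T \<longrightarrow> 0 \<le> u (x, t)" using u(2) by simp
      show "AE x in lebesgue. \<forall>t. 0 < t \<and> ereal t < ereal T \<longrightarrow>
        ennreal (u (x, t)) =
          (\<integral>\<^sup>+ y. ennreal (G (x - y) t) \<partial>function_measure \<mu>) +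
          (\<integral>\<^sup>+ s\<in>{0<..<t}. (\<integral>\<^sup>+ y. ennreal (G (x - y) (t - s) * u (y, s) powr p) \<partial>lebesgue) \<partial>lebesgue)"
        by (intro AE_I2) (simp add: u(3) a_heat heat_fm nn_integral_completion)
    qed
  qed
qed

end
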